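(* Let $\mathbb{F}$ be a field. Given black-box access to a polynomial $f\in\mathbb{F}\{x_1,\ldots,x_n\}$ of degree at most $d$ and with at most $t$ monomials, all the monomials of $f$ and their coefficients can be computed in time $\mathrm{poly}(d,n,t)$. In particular, if $f$ is a sparse polynomial of polynomial degree, it can be reconstructed in polynomial time.
   Context: $\mathbb{F}\{x_1,\ldots,x_n\}$ is the ring of polynomials in noncommuting variables over $\mathbb{F}$. Black-box access means that for any $k$ and any matrices $A_1,\ldots,A_n\in M_k(\mathbb{F})$ (the algebra of $k\times k$ matrices over $\mathbb{F}$) one can query the value $f(A_1,\ldots,A_n)\in M_k(\mathbb{F})$, at cost polynomial in $k$. *)

theory Defs
  imports
    "HOL-Library.Poly_Mapping"
    "HOL-Computational_Algebra.Polynomial"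
    "Jordan_Normal_Form.Matrix"
begin

section \<open>Polynomials in noncommuting variables\<close>

text \<open>
  An element of the free algebra is a finitely supported function from words to coefficients;
  the word \<open>[i, j, \<dots>]\<close> stands for the monomial \<open>x\<^sub>i x\<^sub>j \<dots>\<close>, and the variables of
  \<open>ncpolys n\<close> are numbered from \<open>0\<close> to \<open>n - 1\<close>.  The monomials of \<open>f\<close> are \<open>Poly_Mapping.keys f\<close>.
\<close>

type_synonym 'a ncpoly = "nat list \<Rightarrow>\<^sub>0 'a"

definition ncpolys :: "nat \<Rightarrow> 'a::zero ncpoly set" where
  "ncpolys n = {f. \<forall>w \<in> Poly_Mapping.keys f. set w \<subseteq> {..<n}}"

text \<open>The zero polynomial gets degree \<open>0\<close>.\<close>

definition nc_degree :: "'a::zero ncpoly \<Rightarrow> nat" where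
  "nc_degree f = Max (insert 0 (length ` Poly_Mapping.keys f))"

definition word_mat :: "nat \<Rightarrow> 'a::semiring_1 mat list \<Rightarrow> nat list \<Rightarrow> 'a mat" where
  "word_mat k As w = foldr (\<lambda>i M. As ! i * M) w (1\<^sub>m k)"

definition nc_eval :: "'a::semiring_1 ncpoly \<Rightarrow> nat \<Rightarrow> 'a mat list \<Rightarrow> 'a mat" where
  "nc_eval f k As =
     mat k k (\<lambda>(i, j). \<Sum>w \<in> Poly_Mapping.keys f. Poly_Mapping.lookup f w * word_mat k As w $$ (i, j))"


section \<open>Computations over a field with a black box\<close>

text \<open>
  The machine model is the WHILE language on binary trees, where leaves may
  carry field elements: constructors, selectors, zero tests and field operations have unit cost,
  and there is neither a unit-cost comparison of trees nor unit-cost integer arithmetic.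
  Numbers are written in unary.  Programs mention no field constants besides \<open>0\<close> and \<open>1\<close>.
\<close>

datatype 'a tree = TNil | TLeaf 'a | TNode "'a tree" "'a tree"

fun enc_nat :: "nat \<Rightarrow> 'a tree" where
  "enc_nat 0 = TNil"
| "enc_nat (Suc m) = TNode TNil (enc_nat m)"

fun enc_list :: "'a tree list \<Rightarrow> 'a tree" where
  "enc_list [] = TNil"
| "enc_list (x # xs) = TNode x (enc_list xs)"

definition enc_mat :: "'a mat \<Rightarrow> 'a tree" where
  "enc_mat A = enc_list (map (\<lambda>r. enc_list (map TLeaf r)) (mat_to_list A))"

datatype expr =
    Var nat
  | NilE
  | ConsE expr expr
  | Hd expr
  | Tl expr
  | ZeroF
  | OneF
  | AddF expr expr
  | NegF expr
  | MulF expr expr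
  | InvF expr
  | IsZeroF expr

datatype com =
    Skip
  | Assign nat expr
  | Seq com com
  | Cond expr com com
  | While expr com
  | Query nat expr expr

type_synonym 'a state = "nat \<Rightarrow> 'a tree"

fun lift1 :: "('a \<Rightarrow> 'a) \<Rightarrow> 'a tree \<Rightarrow> 'a tree" where
  "lift1 g (TLeaf a) = TLeaf (g a)"
| "lift1 g _ = TNil"

fun lift2 :: "('a \<Rightarrow> 'a \<Rightarrow> 'a) \<Rightarrow> 'a tree \<Rightarrow> 'a tree \<Rightarrow> 'a tree" where
  "lift2 g (TLeaf a) (TLeaf b) = TLeaf (g a b)"
| "lift2 g _ _ = TNil"

fun hd_tree :: "'a tree \<Rightarrow> 'a tree" where
  "hd_tree (TNode x y) = x"
| "hd_tree _ = TNil"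

fun tl_tree :: "'a tree \<Rightarrow> 'a tree" where
  "tl_tree (TNode x y) = y"
| "tl_tree _ = TNil"

text \<open>\<open>TNil\<close> is false, every other tree is true.  Ill-typed operations yield \<open>TNil\<close>.\<close>

fun expr_val :: "expr \<Rightarrow> 'a::field state \<Rightarrow> 'a tree" where
  "expr_val (Var x) s = s x"
| "expr_val NilE s = TNil"
| "expr_val (ConsE a b) s = TNode (expr_val a s) (expr_val b s)"
| "expr_val (Hd a) s = hd_tree (expr_val a s)"
| "expr_val (Tl a) s = tl_tree (expr_val a s)"
| "expr_val ZeroF s = TLeaf 0"
| "expr_val OneF s = TLeaf 1"
| "expr_val (AddF a b) s = lift2 (+) (expr_val a s) (expr_val b s)"
| "expr_val (NegF a) s = lift1 uminus (expr_val a s)"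
| "expr_val (MulF a b) s = lift2 (*) (expr_val a s) (expr_val b s)"
| "expr_val (InvF a) s = lift1 inverse (expr_val a s)"
| "expr_val (IsZeroF a) s =
     (if expr_val a s = TLeaf 0 then TNode TNil TNil else TNil)"

fun expr_cost :: "expr \<Rightarrow> nat" where
  "expr_cost (ConsE a b) = Suc (expr_cost a + expr_cost b)"
| "expr_cost (Hd a) = Suc (expr_cost a)"
| "expr_cost (Tl a) = Suc (expr_cost a)"
| "expr_cost (AddF a b) = Suc (expr_cost a + expr_cost b)"
| "expr_cost (NegF a) = Suc (expr_cost a)"
| "expr_cost (MulF a b) = Suc (expr_cost a + expr_cost b)"
| "expr_cost (InvF a) = Suc (expr_cost a)"
| "expr_cost (IsZeroF a) = Suc (expr_cost a)"
| "expr_cost _ = 1"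

text \<open>
  \<open>exec n bb qc c s s' t\<close>: started in state \<open>s\<close>, the command \<open>c\<close> terminates in state \<open>s'\<close> in time
  \<open>t\<close>, where \<open>bb k As\<close> is the answer of the black box to the list \<open>As\<close> of \<open>n\<close> matrices of
  dimension \<open>k\<close> and \<open>qc k\<close> is the cost of this query.  The dimension is passed explicitly because
  for \<open>n = 0\<close> it cannot be read off \<open>As\<close>.  A malformed query blocks the computation.
\<close>

inductive exec ::
  "nat \<Rightarrow> (nat \<Rightarrow> 'a::field mat list \<Rightarrow> 'a mat) \<Rightarrow> (nat \<Rightarrow> nat) \<Rightarrow>
   com \<Rightarrow> 'a state \<Rightarrow> 'a state \<Rightarrow> nat \<Rightarrow> bool"
  for n :: nat and bb :: "nat \<Rightarrow> 'a::field mat list \<Rightarrow> 'a mat" and qc :: "nat \<Rightarrow> nat"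
where
  ExSkip: "exec n bb qc Skip s s 1"
| ExAssign: "exec n bb qc (Assign x e) s (s(x := expr_val e s)) (1 + expr_cost e)"
| ExSeq: "exec n bb qc c1 s s' t1 \<Longrightarrow> exec n bb qc c2 s' s'' t2 \<Longrightarrow>
    exec n bb qc (Seq c1 c2) s s'' (t1 + t2)"
| ExCondT: "expr_val e s \<noteq> TNil \<Longrightarrow> exec n bb qc c1 s s' t \<Longrightarrow>
    exec n bb qc (Cond e c1 c2) s s' (1 + expr_cost e + t)"
| ExCondF: "expr_val e s = TNil \<Longrightarrow> exec n bb qc c2 s s' t \<Longrightarrow>
    exec n bb qc (Cond e c1 c2) s s' (1 + expr_cost e + t)"
| ExWhileF: "expr_val e s = TNil \<Longrightarrow>
    exec n bb qc (While e c) s s (1 + expr_cost e)"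
| ExWhileT: "expr_val e s \<noteq> TNil \<Longrightarrow> exec n bb qc c s s' t1 \<Longrightarrow>
    exec n bb qc (While e c) s' s'' t2 \<Longrightarrow>
    exec n bb qc (While e c) s s'' (1 + expr_cost e + t1 + t2)"
| ExQuery: "0 < k \<Longrightarrow> length As = n \<Longrightarrow> set As \<subseteq> carrier_mat k k \<Longrightarrow>
    expr_val e1 s = enc_nat k \<Longrightarrow> expr_val e2 s = enc_list (map enc_mat As) \<Longrightarrow>
    exec n bb qc (Query x e1 e2) s (s(x := enc_mat (bb k As)))
      (1 + expr_cost e1 + expr_cost e2 + qc k)"

text \<open>Input and output are passed in variable \<open>0\<close>; all other variables are initially \<open>TNil\<close>.\<close>

definition computes ::
  "nat \<Rightarrow> (nat \<Rightarrow> 'a::field mat list \<Rightarrow> 'a mat) \<Rightarrow> (nat \<Rightarrow> nat) \<Rightarrow>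
   com \<Rightarrow> 'a tree \<Rightarrow> 'a tree \<Rightarrow> nat \<Rightarrow> bool" where
  "computes n bb qc c inp out t \<longleftrightarrow>
     (\<exists>s'. exec n bb qc c ((\<lambda>_. TNil)(0 := inp)) s' t \<and> s' 0 = out)"

text \<open>
  The tree lists every monomial of \<open>f\<close> exactly once, in some order, together with its coefficient.
\<close>

definition lists_monomials :: "'a tree \<Rightarrow> 'a::zero ncpoly \<Rightarrow> bool" where
  "lists_monomials out f \<longleftrightarrow>
     (\<exists>ws. distinct ws \<and> set ws = Poly_Mapping.keys f \<and>
        out = enc_list
          (map (\<lambda>w. TNode (enc_list (map enc_nat w)) (TLeaf (Poly_Mapping.lookup f w))) ws))"


section \<open>Computations are deterministic\<close>

lemma enc_nat_inject [simp]: "enc_nat k = enc_nat l \<longleftrightarrow> k = l"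
proof (induction k arbitrary: l)
  case 0
  then show ?case by (cases l) auto
next
  case (Suc k)
  then show ?case by (cases l) auto
qed

lemma enc_list_inject [simp]: "enc_list xs = enc_list ys \<longleftrightarrow> xs = ys"
proof (induction xs arbitrary: ys)
  case Nil
  then show ?case by (cases ys) auto
next
  case (Cons x xs)
  then show ?case by (cases ys) auto
qed

lemma enc_mat_inject:
  assumes "A \<in> carrier_mat k k" "B \<in> carrier_mat k k" "enc_mat A = enc_mat B"
  shows "A = B"
proof -
  have "inj (\<lambda>r :: 'a list. enc_list (map TLeaf r))"
    by (auto intro!: injI simp: inj_map_eq_map inj_def)
  then have L: "mat_to_list A = mat_to_list B"
    using assms(3) by (simp add: enc_mat_def inj_map_eq_map)
  show ?thesis
  proof (rule eq_matI)
    fix i j assume "i < dim_row B" "j < dim_col B"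
    moreover have "mat_to_list A ! i ! j = mat_to_list B ! i ! j" by (simp add: L)
    ultimately show "A $$ (i, j) = B $$ (i, j)"
      using assms(1,2) by (simp add: mat_to_list_def)
  qed (use assms in auto)
qed

lemma enc_mats_inject:
  assumes "set As \<subseteq> carrier_mat k k" "set Bs \<subseteq> carrier_mat k k"
    and "map enc_mat As = map enc_mat Bs"
  shows "As = Bs"
  using assms
proof (induction As arbitrary: Bs)
  case (Cons A As)
  then show ?case by (cases Bs) (auto dest: enc_mat_inject)
qed simp

lemma exec_deterministic:
  assumes "exec n bb qc c s s1 t1" "exec n bb qc c s s2 t2"
  shows "s1 = s2 \<and> t1 = t2"
  using assms
proof (induction arbitrary: s2 t2 rule: exec.induct)
  case ExSkip
  then show ?case by (auto elim: exec.cases)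
next
  case ExAssign
  then show ?case by (auto elim: exec.cases)
next
  case (ExSeq c1 s s' t1 c2 s'' t2')
  from ExSeq.prems show ?case
    by (cases rule: exec.cases) (use ExSeq.IH in blast)+
next
  case (ExCondT e s c1 s' t c2)
  from ExCondT.prems show ?case
    by (cases rule: exec.cases) (use ExCondT.IH ExCondT.hyps in blast)+
next
  case (ExCondF e s c2 s' t c1)
  from ExCondF.prems show ?case
    by (cases rule: exec.cases) (use ExCondF.IH ExCondF.hyps in blast)+
next
  case (ExWhileF e s c)
  from ExWhileF.prems show ?case
    by (cases rule: exec.cases) (use ExWhileF.hyps in auto)
next
  case (ExWhileT e s c s' t1 s'' t2')
  from ExWhileT.prems show ?case
    by (cases rule: exec.cases) (use ExWhileT.IH ExWhileT.hyps in blast)+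
next
  case (ExQuery k As e1 s e2 x)
  from ExQuery.prems show ?case
  proof (cases rule: exec.cases)
    case (ExQuery k' As')
    with \<open>expr_val e1 s = enc_nat k\<close> have "k' = k" by simp
    moreover from this have "As' = As"
      using ExQuery \<open>set As \<subseteq> carrier_mat k k\<close>
        \<open>expr_val e2 s = enc_list (map enc_mat As)\<close>
      by (intro enc_mats_inject[of _ k]) auto
    ultimately show ?thesis using ExQuery by simp
  qed
qed

end

theory Submission
  imports Defs
begin

text \<open>
  For a prefix \<open>u\<close> and a modulus \<open>m\<close>, let the matrices be the transition matrices of a deterministic
  automaton that reads \<open>u\<close> and then computes the number coded by the remaining word modulo \<open>m\<close>.  The
  first row of the answer of the black box contains, for every residue \<open>j\<close>, the sum of the coefficients
  of the monomials \<open>u v\<close> with the code of \<open>v\<close> congruent to \<open>j\<close>.  Since \<open>lcm(1, \<dots>, M) \<ge> 2^(M - 1)\<close>,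
  the product of the at most \<open>t\<close> differences between the codes of distinct suffixes, each at most
  \<open>2^(n d)\<close>, is not divisible by every \<open>m \<le> n d t + 2\<close>.  Hence some modulus isolates a monomial with
  prefix \<open>u\<close>, if there is one, and it cannot cancel.  So the queries decide which words are prefixes
  of monomials; a breadth-first search over the prefixes, at most \<open>n t + 1\<close> candidates of each length,
  finds all monomials.
\<close>

text \<open>The automata substitute no such elements: their matrices have entries 0 and 1, the
  argument is the same over every field, and all that is needed is one sum with exactly one summand.
  The codes are exponentially large and exist only in the proof. The matrices carry residues, and
  since the isolating modulus is unknown, all small moduli are tried. The machine has unary numbers
  only and no comparison of trees. The second half therefore builds a small language whose loops are
  bounded and whose time bound is read off the syntax; what remains is to bound every loop and every
  query dimension by one number \<open>K\<close>.\<close>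

subsection \<open>Moduli that isolate a word\<close>

text \<open>
  The numbers \<open>1 / (k (n choose k))\<close> form Leibniz's harmonic triangle: the entry for \<open>(n, k + 1)\<close> is
  the difference of those for \<open>(n - 1, k)\<close> and \<open>(n, k)\<close>.
\<close>

lemma leibniz_dvd_Lcm:
  assumes "1 \<le> k" "k \<le> n"
  shows "k * (n choose k) dvd Lcm {1..n::nat}"
  using assms
proof (induction k arbitrary: n rule: dec_induct)
  case base
  then show ?case by (auto intro: dvd_Lcm)
next
  case (step k)
  then obtain m where n: "n = Suc m" and m: "k \<le> m" by (cases n) auto
  define L where "L = Lcm {1..n}"
  have "Lcm {1..m} dvd L"
    unfolding L_def n by (rule Lcm_subset) auto
  then have "k * (m choose k) dvd L"
    using step.IH[of m] step.prems m by (auto intro: dvd_trans)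
  then obtain a where a: "L = k * (m choose k) * a" ..
  have "k * (n choose k) dvd L"
    using step.IH[of n] step.prems by (auto simp: L_def)
  then obtain b where b: "L = k * (n choose k) * b" ..
  let ?c = "Suc k * (n choose Suc k)"
  have absorb: "Suc k * (n choose Suc k) = Suc m * (m choose k)"
    unfolding n by (rule Suc_times_binomial)
  have absorb': "(n choose k) * (n - k) = n * (m choose k)"
    using binomial_absorb_comp[of n k] by (simp add: n mult.commute)
  have "real (m choose k) > 0" "real (n choose k) > 0" "real k > 0"
    using m step.hyps by (auto simp: n)
  \<comment> \<open>\<open>a\<close> and \<open>b\<close> are \<open>L\<close> times the triangle
    entries for \<open>(m, k)\<close> and \<open>(n, k)\<close>, so their difference is
    \<open>L\<close> times the entry \<open>1 / ?c\<close>. The reals allow cancelling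
    \<open>k\<close>; the identity then returns to the integers, where it is a divisibility.\<close>
  have "real ?c * (real a - real b) = real L"
  proof -
    have "real ?c * real a * real k = real n * real L"
    proof -
      have "?c * a * k = Suc m * (m choose k) * a * k" by (simp only: absorb)
      also have "\<dots> = n * L" by (simp only: n a mult_ac)
      finally have "?c * a * k = n * L" .
      then show ?thesis by (metis of_nat_mult)
    qed
    moreover have "real ?c * real b * real k = real (n - k) * real L"
    proof -
      have "?c * b * k = (n - k) * L"
        unfolding absorb b n[symmetric] using absorb' by (metis mult.assoc mult.commute)
      then show ?thesis by (metis of_nat_mult)
    qed
    ultimately have "real k * (real ?c * (real a - real b)) = (real n - real (n - k)) * real L"
      by (simp add: algebra_simps)
    also have "real n - real (n - k) = real k"
      using m n by (simp add: of_nat_diff)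
    finally show ?thesis using \<open>real k > 0\<close> by simp
  qed
  then have "real_of_int (int ?c * (int a - int b)) = real_of_int (int L)"
    by (simp only: of_int_mult of_int_diff of_int_of_nat_eq)
  then have "int ?c * (int a - int b) = int L"
    by (simp only: of_int_eq_iff)
  then have "int ?c dvd int L" by (metis dvd_triv_left)
  then show ?case unfolding L_def by (simp only: int_dvd_int_iff)
qed

text \<open>Row \<open>Suc n\<close> of the triangle gives \<open>n + 1\<close> divisors
  \<open>Suc n * (n choose k)\<close> of the lcm. Their sum is \<open>Suc n * 2 ^ n\<close>, so the
  lcm is at least their average.\<close>

lemma Lcm_lower_bound: "2 ^ n \<le> Lcm {1..Suc n}"
proof -
  let ?L = "Lcm {1..Suc n}"
  have "?L \<noteq> 0" by (simp add: Lcm_0_iff del: atLeastAtMostSuc_conv)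
  then have "0 < ?L" by (rule neq0_conv[THEN iffD1])
  have "Suc n * (n choose k) \<le> ?L" if "k \<le> n" for k
  proof -
    have "Suc n * (n choose k) dvd ?L"
      using leibniz_dvd_Lcm[of "Suc k" "Suc n"] that by (simp only: Suc_times_binomial)
    then show ?thesis using \<open>0 < ?L\<close> by (rule dvd_imp_le)
  qed
  then have "(\<Sum>k\<le>n. Suc n * (n choose k)) \<le> (\<Sum>k\<le>n. ?L)"
    by (intro sum_mono) auto
  also have "(\<Sum>k\<le>n. Suc n * (n choose k)) = Suc n * 2 ^ n"
    by (simp only: sum_distrib_left[symmetric] choose_row_sum)
  finally have "Suc n * 2 ^ n \<le> Suc n * ?L"
    by (simp only: sum_constant card_atMost of_nat_id)
  then show ?thesis by (simp only: Suc_mult_le_cancel1)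
qed

text \<open>Bijective numeration in base \<open>n + 1\<close>: the letter \<open>i\<close> is the digit \<open>i + 1\<close>.\<close>

definition word_code :: "nat \<Rightarrow> nat \<Rightarrow> nat list \<Rightarrow> nat" where
  "word_code n = foldl (\<lambda>h i. Suc (i + h * Suc n))"

lemma word_code_less:
  assumes "set w \<subseteq> {..<n}"
  shows "word_code n 0 w < Suc n ^ length w"
  using assms
proof (induction w rule: rev_induct)
  case (snoc i w)
  then have "Suc (word_code n 0 w) * Suc n \<le> Suc n ^ length w * Suc n" "i < n"
    by (auto intro!: mult_right_mono simp del: mult_Suc mult_Suc_right)
  then have "Suc (i + word_code n 0 w * Suc n) < Suc n ^ length w * Suc n"
    by (simp only: mult_Suc)
  then show ?case by (simp add: word_code_def mult.commute)
qed (simp add: word_code_def)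

text \<open>The last digit is recovered modulo \<open>Suc n\<close>. No digit is 0, so a nonempty
  word never has the code of the empty one, and words of different lengths cannot collide.\<close>

lemma word_code_inj:
  assumes "set v \<subseteq> {..<n}" "set w \<subseteq> {..<n}" "word_code n 0 v = word_code n 0 w"
  shows "v = w"
  using assms
proof (induction v arbitrary: w rule: rev_induct)
  case Nil
  then show ?case by (cases w rule: rev_cases) (auto simp: word_code_def)
next
  case (snoc i v)
  show ?case
  proof (cases w rule: rev_cases)
    case Nil
    then show ?thesis using snoc.prems by (simp add: word_code_def)
  next
    case (snoc w' j)
    let ?c = "word_code n 0"
    have eq: "i + ?c v * Suc n = j + ?c w' * Suc n" and ij: "i < Suc n" "j < Suc n"
      using snoc snoc.prems snoc.prems(3) by (auto simp: word_code_def)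
    from eq have "(i + ?c v * Suc n) mod Suc n = (j + ?c w' * Suc n) mod Suc n" by simp
    then have "i = j" using ij by (simp only: mod_mult_self1 mod_less)
    with eq have "?c v = ?c w'" by (simp del: mult_Suc_right)
    with snoc.IH snoc.prems snoc \<open>i = j\<close> show ?thesis by simp
  qed
qed

text \<open>Only \<open>v\<close> has to be separated from the other words, not all pairs from each
  other. Hence fewer than \<open>t\<close> differences enter the product, and the bound stays linear
  in \<open>t\<close>.\<close>

lemma isolating_modulus:
  assumes fin: "finite V" and card: "card V \<le> t" and v: "v \<in> V"
    and V: "\<And>w. w \<in> V \<Longrightarrow> set w \<subseteq> {..<n} \<and> length w \<le> d"
  obtains m where "1 \<le> m" "m < n * d * t + 3"
    "\<And>w. w \<in> V \<Longrightarrow> w \<noteq> v \<Longrightarrow> word_code n 0 w mod m \<noteq> word_code n 0 v mod m"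
proof (rule ccontr)
  assume contra: "\<not> thesis"
  note isolates = that
  let ?c = "\<lambda>w. int (word_code n 0 w)"
  define D where "D w = nat \<bar>?c w - ?c v\<bar>" for w
  define P where "P = (\<Prod>w\<in>V - {v}. D w)"
  have D_bound: "1 \<le> D w \<and> D w \<le> 2 ^ (n * d)" if w: "w \<in> V - {v}" for w
  proof
    have "word_code n 0 w \<noteq> word_code n 0 v"
      using word_code_inj[of w n v] w V v by auto
    then show "1 \<le> D w" by (simp add: D_def)
    have "word_code n 0 x < 2 ^ (n * d)" if "x \<in> V" for x
    proof -
      have "word_code n 0 x < Suc n ^ length x" using V that by (intro word_code_less) auto
      also have "\<dots> \<le> Suc n ^ d" using V that by (intro power_increasing) auto
      also have "\<dots> \<le> (2 ^ n) ^ d"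
        by (intro power_mono) (auto simp: Suc_le_eq less_exp)
      finally show ?thesis by (simp add: power_mult)
    qed
    then have "word_code n 0 w < 2 ^ (n * d)" "word_code n 0 v < 2 ^ (n * d)"
      using w v by auto
    then show "D w \<le> 2 ^ (n * d)" unfolding D_def by linarith
  qed
  \<comment> \<open>Moduli up to \<open>n * d * t + 2\<close> put the lcm at
    \<open>2 ^ (n * d * t + 1)\<close> or above, strictly beyond the bound
    \<open>2 ^ (n * d * t)\<close> on \<open>P\<close>.\<close>
  have "m dvd P" if m: "m \<in> {1..Suc (n * d * t + 1)}" for m
  proof -
    obtain w where w: "w \<in> V" "w \<noteq> v" "word_code n 0 w mod m = word_code n 0 v mod m"
      using contra isolates[of m] m by fastforce
    then have "?c w mod int m = ?c v mod int m" by (metis of_nat_mod)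
    then have "int m dvd ?c w - ?c v" by (simp only: mod_eq_dvd_iff)
    then have "int m dvd int (D w)" by (simp add: D_def)
    then have "m dvd D w" by (simp only: int_dvd_int_iff)
    moreover have "D w dvd P" unfolding P_def using w fin by (intro dvd_prodI) auto
    ultimately show ?thesis by (rule dvd_trans)
  qed
  then have "Lcm {1..Suc (n * d * t + 1)} dvd P" by (rule Lcm_least)
  moreover have "P > 0" unfolding P_def using D_bound by (intro prod_pos) force
  ultimately have "Lcm {1..Suc (n * d * t + 1)} \<le> P" by (rule dvd_imp_le)
  also have "P \<le> (\<Prod>w\<in>V - {v}. 2 ^ (n * d))"
    unfolding P_def using D_bound by (intro prod_mono) auto
  also have "\<dots> = (2 ^ (n * d)) ^ card (V - {v})" by simp
  also have "\<dots> \<le> (2 ^ (n * d)) ^ t"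
    using card fin v by (intro power_increasing) (auto simp: card_Diff_singleton)
  also have "\<dots> < 2 ^ (n * d * t + 1)" by (simp add: power_mult)
  finally show False using Lcm_lower_bound[of "n * d * t + 1"] by simp
qed

subsection \<open>Prefix automata\<close>

text \<open>
  The states \<open>r < length u\<close> spell the prefix \<open>u\<close>; the state \<open>length u + h\<close> means that \<open>u\<close> has been read
  and that the code of the rest is \<open>h\<close> modulo \<open>m\<close>.  The states are \<open>0, \<dots>, length u + m\<close>, and a step
  beyond them rejects.  As \<open>x mod 0 = x\<close>, for \<open>m = 0\<close> any letter after \<open>u\<close> rejects, so that this case
  isolates the word \<open>u\<close> itself.
\<close>

definition step :: "nat \<Rightarrow> nat list \<Rightarrow> nat \<Rightarrow> nat \<Rightarrow> nat \<Rightarrow> nat" where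
  "step n u m r i =
     (if r < length u then if u ! r = i then Suc r else Suc (length u + m)
      else length u + Suc (i + (r - length u) * Suc n) mod m)"

text \<open>A rejecting step points outside the matrix and leaves a zero row, so no sink state is
  needed. The dimension keeps the state \<open>length u\<close> present even for
  \<open>m = 0\<close>.\<close>

definition step_mats :: "nat \<Rightarrow> nat list \<Rightarrow> nat \<Rightarrow> 'a::zero_neq_one mat list" where
  "step_mats n u m =
     map (\<lambda>i. mat (Suc (length u + m)) (Suc (length u + m))
       (\<lambda>(r, c). if step n u m r i = c then 1 else 0)) [0..<n]"

fun run :: "nat \<Rightarrow> nat list \<Rightarrow> nat \<Rightarrow> nat \<Rightarrow> nat list \<Rightarrow> nat option" where
  "run n u m r [] = Some r"
| "run n u m r (i # w) =
     (if step n u m r i \<le> length u + m then run n u m (step n u m r i) w else None)"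

text \<open>The automaton is deterministic: each row of a letter matrix has at most one 1, so the
  sum in the matrix product collapses to the entry of the successor state.\<close>

lemma word_mat_step_mats:
  assumes "set w \<subseteq> {..<n}" and k: "k = Suc (length u + m)"
  shows "word_mat k (step_mats n u m :: 'a::semiring_1 mat list) w \<in> carrier_mat k k \<and>
    (\<forall>r<k. \<forall>c<k. word_mat k (step_mats n u m :: 'a mat list) w $$ (r, c) =
      (if run n u m r w = Some c then 1 else 0))"
  using assms(1)
proof (induction w)
  case Nil
  then show ?case by (auto simp: word_mat_def)
next
  case (Cons i w)
  let ?A = "step_mats n u m ! i :: 'a mat" and ?M = "word_mat k (step_mats n u m :: 'a mat list) w"
  have A: "?A = mat k k (\<lambda>(r, c). if step n u m r i = c then 1 else 0)"
    using Cons.prems by (simp add: step_mats_def k)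
  have M: "?M \<in> carrier_mat k k"
    and M': "\<And>r c. r < k \<Longrightarrow> c < k \<Longrightarrow> ?M $$ (r, c) = (if run n u m r w = Some c then 1 else 0)"
    using Cons by auto
  have eq: "word_mat k (step_mats n u m :: 'a mat list) (i # w) = ?A * ?M"
    by (simp add: word_mat_def)
  have "(?A * ?M) $$ (r, c) = (if run n u m r (i # w) = Some c then 1 else 0)"
    if "r < k" "c < k" for r c
  proof -
    have "(?A * ?M) $$ (r, c) = (\<Sum>j<k. ?A $$ (r, j) * ?M $$ (j, c))"
      using that M by (simp add: A scalar_prod_def atLeast0LessThan)
    also have "\<dots> = (\<Sum>j<k. (if step n u m r i = j then ?M $$ (j, c) else 0))"
      using that by (intro sum.cong) (auto simp: A)
    also have "\<dots> = (if step n u m r i < k then ?M $$ (step n u m r i, c) else 0)"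
      by (simp add: sum.delta)
    finally show ?thesis using that M' by (auto simp: k)
  qed
  then show ?case unfolding eq using M by (auto simp: A)
qed

lemma nc_eval_step_mats:
  assumes "f \<in> ncpolys n" "k = Suc (length u + m)" "j \<le> m"
  shows "nc_eval f k (step_mats n u m :: 'a::semiring_1 mat list) $$ (0, length u + j) =
    (\<Sum>w \<in> Poly_Mapping.keys f.
       if run n u m 0 w = Some (length u + j) then Poly_Mapping.lookup f w else 0)"
proof -
  have "word_mat k (step_mats n u m :: 'a mat list) w $$ (0, length u + j) =
      (if run n u m 0 w = Some (length u + j) then 1 else 0)" if "w \<in> Poly_Mapping.keys f" for w
  proof -
    have "set w \<subseteq> {..<n}" using assms(1) that by (auto simp: ncpolys_def)
    moreover have "0 < k" "length u + j < k" using assms(2,3) by auto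
    ultimately show ?thesis using word_mat_step_mats[OF _ assms(2)] by blast
  qed
  then show ?thesis
    using assms(2,3) by (auto simp: nc_eval_def intro!: sum.cong)
qed

text \<open>A state below \<open>length u\<close> can be left only by the matching letter of
  \<open>u\<close>, so a run that ends at \<open>c\<close> must first spell the rest of
  \<open>u\<close>. The induction needs every starting point \<open>r\<close>.\<close>

lemma run_prefix:
  assumes "r \<le> length u" "length u \<le> c"
  shows "run n u m r w = Some c \<longleftrightarrow>
    (\<exists>v. w = drop r u @ v \<and> run n u m (length u) v = Some c)"
  using assms(1)
proof (induction w arbitrary: r)
  case Nil
  with assms(2) show ?case by auto
next
  case (Cons i w)
  show ?case
  proof (cases "r < length u")
    case True
    with Cons.IH[of "Suc r"] show ?thesis
      by (auto simp: step_def Cons_nth_drop_Suc[symmetric])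
  next
    case False
    with Cons.prems show ?thesis by simp
  qed
qed

text \<open>Reducing after every letter gives the same residue as reducing once at the end. The
  start value \<open>h\<close> is arbitrary because the code is accumulated from the left.\<close>

lemma run_suffix:
  assumes "0 < m"
  shows "run n u m (length u + h mod m) v = Some (length u + word_code n h v mod m)"
proof (induction v arbitrary: h)
  case Nil
  then show ?case by (simp add: word_code_def)
next
  case (Cons i v)
  have "Suc (i + h mod m * Suc n) mod m = Suc (i + h * Suc n) mod m"
    by (metis mod_Suc_eq mod_add_right_eq mod_mult_left_eq)
  then have "step n u m (length u + h mod m) i = length u + Suc (i + h * Suc n) mod m"
    by (simp add: step_def del: mult_Suc_right)
  moreover have "Suc (i + h * Suc n) mod m \<le> m" using assms by (simp add: less_imp_le)
  ultimately show ?case using Cons.IH[of "Suc (i + h * Suc n)"]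
    by (simp add: word_code_def del: mult_Suc_right)
qed

lemma run_suffix_0: "run n u 0 (length u) v = Some c \<longleftrightarrow> v = [] \<and> c = length u"
  by (cases v) (auto simp: step_def)

definition prefix_value :: "'a::semiring_1 ncpoly \<Rightarrow> nat \<Rightarrow> nat list \<Rightarrow> nat \<Rightarrow> nat \<Rightarrow> 'a" where
  "prefix_value f n u m j =
     nc_eval f (Suc (length u + m)) (step_mats n u m) $$ (0, length u + j)"

lemma prefix_value_0:
  assumes "f \<in> ncpolys n"
  shows "prefix_value f n u 0 0 = Poly_Mapping.lookup f u"
proof -
  have "run n u 0 0 w = Some (length u + 0) \<longleftrightarrow> w = u" for w
    using run_prefix[of 0 u "length u" n 0 w] by (auto simp: run_suffix_0)
  then show ?thesis
    unfolding prefix_value_def nc_eval_step_mats[OF assms refl le_refl]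
    by (auto simp: sum.delta in_keys_iff)
qed

lemma prefix_value_pos:
  assumes "f \<in> ncpolys n" "0 < m" "j \<le> m"
  shows "prefix_value f n u m j =
    (\<Sum>w \<in> Poly_Mapping.keys f.
       if \<exists>v. w = u @ v \<and> word_code n 0 v mod m = j then Poly_Mapping.lookup f w else 0)"
proof -
  have "run n u m 0 w = Some (length u + j) \<longleftrightarrow> (\<exists>v. w = u @ v \<and> word_code n 0 v mod m = j)" for w
    using run_prefix[of 0 u "length u + j" n m w] run_suffix[OF assms(2), of n u 0] by auto
  then show ?thesis
    unfolding prefix_value_def nc_eval_step_mats[OF assms(1) refl assms(3)] by (simp only:)
qed

text \<open>With \<open>j \<le> m\<close> instead of \<open>j < m\<close> the case
  \<open>m = 0\<close> contributes its entry \<open>j = 0\<close>, and the entries are exactly the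
  first row from column \<open>length u\<close> on.\<close>

definition live :: "'a::semiring_1 ncpoly \<Rightarrow> nat \<Rightarrow> nat \<Rightarrow> nat list \<Rightarrow> bool" where
  "live f n M u \<longleftrightarrow> (\<exists>m<M. \<exists>j\<le>m. prefix_value f n u m j \<noteq> 0)"

lemma live_iff_prefix:
  assumes f: "f \<in> ncpolys n" and deg: "nc_degree f \<le> d" and card: "card (Poly_Mapping.keys f) \<le> t"
  shows "live f n (n * d * t + 3) u \<longleftrightarrow> (\<exists>v. u @ v \<in> Poly_Mapping.keys f)"
proof
  assume "live f n (n * d * t + 3) u"
  then obtain m j where mj: "j \<le> m" "prefix_value f n u m j \<noteq> 0" by (auto simp: live_def)
  show "\<exists>v. u @ v \<in> Poly_Mapping.keys f"
  proof (rule ccontr)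
    assume none: "\<not> ?thesis"
    have "prefix_value f n u m j = 0"
    proof (cases "m = 0")
      case True
      \<comment> \<open>For \<open>m = 0\<close> the value is the coefficient of \<open>u\<close>
        itself, which vanishes because \<open>u @ []\<close> is no monomial.\<close>
      with none[simplified, rule_format, of "[]"] mj(1) show ?thesis
        by (simp add: prefix_value_0[OF f] in_keys_iff)
    next
      case False
      with none mj(1) show ?thesis by (auto simp: prefix_value_pos[OF f] intro!: sum.neutral)
    qed
    with mj(2) show False ..
  qed
next
  assume "\<exists>v. u @ v \<in> Poly_Mapping.keys f"
  then obtain v where v: "u @ v \<in> Poly_Mapping.keys f" ..
  define V where "V = {v. u @ v \<in> Poly_Mapping.keys f}"
  have img: "(\<lambda>v. u @ v) ` V \<subseteq> Poly_Mapping.keys f" and inj: "inj_on (\<lambda>v. u @ v) V"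
    by (auto simp: V_def inj_on_def)
  have fin: "finite V" using finite_subset[OF img finite_keys] inj by (rule finite_imageD)
  have cardV: "card V \<le> t"
    using card_mono[OF finite_keys img] card_image[OF inj] card by simp
  have V: "set w \<subseteq> {..<n} \<and> length w \<le> d" if "w \<in> V" for w
  proof -
    have "u @ w \<in> Poly_Mapping.keys f" using that by (simp add: V_def)
    moreover from this have "length (u @ w) \<le> nc_degree f"
      unfolding nc_degree_def by (intro Max_ge) (auto simp del: length_append)
    moreover have "set (u @ w) \<subseteq> {..<n}"
      using f \<open>u @ w \<in> Poly_Mapping.keys f\<close> unfolding ncpolys_def by blast
    ultimately show ?thesis using deg by auto
  qed
  have "v \<in> V" using v by (simp add: V_def)
  then obtain m where m: "1 \<le> m" "m < n * d * t + 3"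
    and sep: "\<And>w. w \<in> V \<Longrightarrow> w \<noteq> v \<Longrightarrow> word_code n 0 w mod m \<noteq> word_code n 0 v mod m"
    using isolating_modulus[OF fin cardV _ V, of v] by metis
  let ?j = "word_code n 0 v mod m"
  have "?j \<le> m" using m by (simp add: less_imp_le)
  \<comment> \<open>Monomials that start with \<open>u\<close> have their suffix in
    \<open>V\<close>, where \<open>m\<close> separates \<open>v\<close> from all others. The sum
    thus shrinks to the coefficient of \<open>u @ v\<close>.\<close>
  have only: "(\<exists>v'. w = u @ v' \<and> word_code n 0 v' mod m = ?j) \<longleftrightarrow> w = u @ v"
    if "w \<in> Poly_Mapping.keys f" for w
    using sep that by (auto simp: V_def)
  have "prefix_value f n u m ?j =
      (\<Sum>w \<in> Poly_Mapping.keys f. if w = u @ v then Poly_Mapping.lookup f w else 0)"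
    using m by (subst prefix_value_pos[OF f _ \<open>?j \<le> m\<close>]) (auto intro!: sum.cong simp only: only)
  also have "\<dots> \<noteq> 0" using v by (simp add: sum.delta' in_keys_iff)
  finally show "live f n (n * d * t + 3) u"
    using m \<open>?j \<le> m\<close> unfolding live_def by blast
qed

subsection \<open>A functional language with time bounds\<close>

text \<open>The only loop runs over a list that is evaluated once, so every loop with a terminating
  body terminates. The length of that list is not visible in the syntax and has to be bounded at
  each use.\<close>

datatype tm =
    Ret expr
  | Bind tm tm
  | Branch expr tm tm
  | Iter expr tm tm
  | Ask expr expr

fun evars :: "expr \<Rightarrow> nat set" where
  "evars (Var x) = {x}"
| "evars NilE = {}"
| "evars (ConsE a b) = evars a \<union> evars b"
| "evars (Hd a) = evars a"
| "evars (Tl a) = evars a"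
| "evars ZeroF = {}"
| "evars OneF = {}"
| "evars (AddF a b) = evars a \<union> evars b"
| "evars (NegF a) = evars a"
| "evars (MulF a b) = evars a \<union> evars b"
| "evars (InvF a) = evars a"
| "evars (IsZeroF a) = evars a"

lemma expr_val_cong: "(\<And>x. x \<in> evars e \<Longrightarrow> s x = s' x) \<Longrightarrow> expr_val e s = expr_val e s'"
  by (induction e) auto

text \<open>
  At level \<open>k\<close> the compiled program leaves its result in variable \<open>k\<close> and preserves all smaller
  variables.  While the body of an \<open>Iter\<close> runs (at level \<open>k + 3\<close>), the variables \<open>k\<close>, \<open>k + 1\<close> and \<open>k + 2\<close> hold
  the accumulator, the list of remaining elements and the current element.  For a loop over a unary
  number \<open>N\<close>, variable \<open>k + 1\<close> is thus a loop index that runs from \<open>N - 1\<close> down to \<open>0\<close>.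
\<close>

fun compile :: "tm \<Rightarrow> nat \<Rightarrow> com" where
  "compile (Ret e) k = Assign k e"
| "compile (Bind a b) k =
     Seq (compile a k) (Seq (compile b (Suc k)) (Assign k (Var (Suc k))))"
| "compile (Branch e a b) k = Cond e (compile a k) (compile b k)"
| "compile (Iter e a b) k =
     Seq (compile a k) (Seq (Assign (k + 1) e)
       (While (Var (k + 1))
         (Seq (Assign (k + 2) (Hd (Var (k + 1))))
           (Seq (Assign (k + 1) (Tl (Var (k + 1))))
             (Seq (compile b (k + 3)) (Assign k (Var (k + 3))))))))"
| "compile (Ask e1 e2) k = Query k e1 e2"

text \<open>
  A bound on the running time, as a polynomial in a common bound for the lengths of all lists
  iterated over and the dimensions of all queries.
\<close>

fun tpoly :: "nat poly \<Rightarrow> tm \<Rightarrow> nat poly" where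
  "tpoly q (Ret e) = [:1 + expr_cost e:]"
| "tpoly q (Bind a b) = tpoly q a + tpoly q b + [:2:]"
| "tpoly q (Branch e a b) = tpoly q a + tpoly q b + [:1 + expr_cost e:]"
| "tpoly q (Iter e a b) =
     tpoly q a + [:3 + expr_cost e:] + [:0, 1:] * (tpoly q b + [:10:])"
| "tpoly q (Ask e1 e2) = [:1 + expr_cost e1 + expr_cost e2:] + q"

lemma poly_nat_mono: "a \<le> b \<Longrightarrow> poly (p :: nat poly) a \<le> poly p b"
  by (induction p) (auto intro: add_mono mult_mono)

section \<open>Rules for the results and running times of compiled programs\<close>

locale machine =
  fixes n :: nat and bb :: "nat \<Rightarrow> 'a::field mat list \<Rightarrow> 'a mat" and q :: "nat poly" and K :: nat
begin

abbreviation ex :: "com \<Rightarrow> 'a state \<Rightarrow> 'a state \<Rightarrow> nat \<Rightarrow> bool" where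
  "ex \<equiv> exec n bb (poly q)"

text \<open>Total correctness with a time bound. Only the variables below \<open>k\<close> of
  \<open>s\<close> matter: the actual start state \<open>s0\<close> may hold leftovers of earlier
  computations in all others.\<close>

definition res :: "tm \<Rightarrow> nat \<Rightarrow> 'a state \<Rightarrow> ('a tree \<Rightarrow> bool) \<Rightarrow> bool" where
  "res t k s Q \<longleftrightarrow>
     (\<forall>s0. (\<forall>x<k. s0 x = s x) \<longrightarrow>
       (\<exists>s1 T. ex (compile t k) s0 s1 T \<and> (\<forall>x<k. s1 x = s x) \<and> Q (s1 k)
          \<and> T \<le> poly (tpoly q t) K))"

lemma resI:
  assumes "\<And>s0. (\<And>x. x < k \<Longrightarrow> s0 x = s x) \<Longrightarrow>
    \<exists>s1 T. ex (compile t k) s0 s1 T \<and> (\<forall>x<k. s1 x = s x) \<and> Q (s1 k) \<and> T \<le> poly (tpoly q t) K"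
  shows "res t k s Q"
  using assms by (simp add: res_def)

lemma resE:
  assumes "res t k s Q" "\<And>x. x < k \<Longrightarrow> s0 x = s x"
  obtains s1 T where "ex (compile t k) s0 s1 T" "\<And>x. x < k \<Longrightarrow> s1 x = s x" "Q (s1 k)"
    "T \<le> poly (tpoly q t) K"
proof -
  have "\<exists>s1 T. ex (compile t k) s0 s1 T \<and> (\<forall>x<k. s1 x = s x) \<and> Q (s1 k) \<and> T \<le> poly (tpoly q t) K"
    using assms unfolding res_def by simp
  then show ?thesis using that by blast
qed

lemma res_mono: "res t k s Q \<Longrightarrow> (\<And>v. Q v \<Longrightarrow> R v) \<Longrightarrow> res t k s R"
  unfolding res_def by meson

lemma res_Ret:
  assumes "evars e \<subseteq> {..<k}" "Q (expr_val e s)"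
  shows "res (Ret e) k s Q"
proof (rule resI)
  fix s0 assume eq: "\<And>x. x < k \<Longrightarrow> s0 x = s x"
  then have "expr_val e s0 = expr_val e s"
    using assms(1) by (intro expr_val_cong) auto
  then have "ex (compile (Ret e) k) s0 (s0(k := expr_val e s)) (1 + expr_cost e)"
    using ExAssign[of n bb "poly q" k e s0] by simp
  with assms(2) eq show "\<exists>s1 T. ex (compile (Ret e) k) s0 s1 T \<and> (\<forall>x<k. s1 x = s x) \<and> Q (s1 k)
      \<and> T \<le> poly (tpoly q (Ret e)) K"
    by (intro exI[of _ "s0(k := expr_val e s)"] exI[of _ "1 + expr_cost e"]) auto
qed

text \<open>The level \<open>k'\<close> is tied to \<open>Suc k\<close> by an equation so that a
  numeral can be supplied for it.\<close>

lemma res_Bind: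
  assumes a: "res a k s R" and k': "k' = Suc k"
    and b': "\<And>v. R v \<Longrightarrow> res b k' (s(k := v)) Q"
  shows "res (Bind a b) k s Q"
proof (rule resI)
  note b = b'[unfolded k']
  fix s0 assume eq: "\<And>x. x < k \<Longrightarrow> s0 x = s x"
  from a eq obtain s1 T1 where 1: "ex (compile a k) s0 s1 T1" "\<And>x. x < k \<Longrightarrow> s1 x = s x"
    "R (s1 k)" "T1 \<le> poly (tpoly q a) K"
    by (rule resE) auto
  have "\<And>x. x < Suc k \<Longrightarrow> s1 x = (s(k := s1 k)) x"
    using 1(2) by (auto simp: less_Suc_eq)
  with b[OF 1(3)] obtain s2 T2 where 2: "ex (compile b (Suc k)) s1 s2 T2"
    "\<And>x. x < Suc k \<Longrightarrow> s2 x = (s(k := s1 k)) x"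
    "Q (s2 (Suc k))" "T2 \<le> poly (tpoly q b) K"
    by (rule resE) auto
  have 3: "ex (Assign k (Var (Suc k))) s2 (s2(k := s2 (Suc k))) 2"
    using ExAssign[of n bb "poly q" k "Var (Suc k)" s2] by (simp add: numeral_2_eq_2)
  show "\<exists>s1 T. ex (compile (Bind a b) k) s0 s1 T \<and> (\<forall>x<k. s1 x = s x) \<and> Q (s1 k)
      \<and> T \<le> poly (tpoly q (Bind a b)) K"
    using 1(4) 2 ExSeq[OF 1(1) ExSeq[OF 2(1) 3]]
    by (intro exI[of _ "s2(k := s2 (Suc k))"] exI[of _ "T1 + (T2 + 2)"]) auto
qed

lemma res_Branch:
  assumes e: "evars e \<subseteq> {..<k}"
    and a: "expr_val e s \<noteq> TNil \<Longrightarrow> res a k s Q" and b: "expr_val e s = TNil \<Longrightarrow> res b k s Q"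
  shows "res (Branch e a b) k s Q"
proof (rule resI)
  fix s0 assume eq: "\<And>x. x < k \<Longrightarrow> s0 x = s x"
  then have val: "expr_val e s0 = expr_val e s"
    using e by (intro expr_val_cong) auto
  show "\<exists>s1 T. ex (compile (Branch e a b) k) s0 s1 T \<and> (\<forall>x<k. s1 x = s x) \<and> Q (s1 k)
      \<and> T \<le> poly (tpoly q (Branch e a b)) K"
  proof (cases "expr_val e s = TNil")
    case True
    from b[OF True] eq obtain s1 T where "ex (compile b k) s0 s1 T" "\<And>x. x < k \<Longrightarrow> s1 x = s x"
      "Q (s1 k)" "T \<le> poly (tpoly q b) K"
      by (rule resE) auto
    with True val show ?thesis
      using ExCondF[of e s0 n bb "poly q" "compile b k" s1 T "compile a k"]
      by (intro exI[of _ s1] exI[of _ "1 + expr_cost e + T"]) simp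
  next
    case False
    from a[OF False] eq obtain s1 T where "ex (compile a k) s0 s1 T" "\<And>x. x < k \<Longrightarrow> s1 x = s x"
      "Q (s1 k)" "T \<le> poly (tpoly q a) K"
      by (rule resE) auto
    with False val show ?thesis
      using ExCondT[of e s0 n bb "poly q" "compile a k" s1 T "compile b k"]
      by (intro exI[of _ s1] exI[of _ "1 + expr_cost e + T"]) simp
  qed
qed

lemma res_Ask:
  assumes "evars e1 \<subseteq> {..<l}" "evars e2 \<subseteq> {..<l}"
    and "expr_val e1 s = enc_nat k" "expr_val e2 s = enc_list (map enc_mat As)"
    and "0 < k" "k \<le> K" "length As = n" "set As \<subseteq> carrier_mat k k"
    and "Q (enc_mat (bb k As))"
  shows "res (Ask e1 e2) l s Q"
proof (rule resI)
  fix s0 assume eq: "\<And>x. x < l \<Longrightarrow> s0 x = s x"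
  then have "expr_val e1 s0 = expr_val e1 s" "expr_val e2 s0 = expr_val e2 s"
    using assms(1,2) by (intro expr_val_cong; auto)+
  with assms have *: "ex (compile (Ask e1 e2) l) s0 (s0(l := enc_mat (bb k As)))
      (1 + expr_cost e1 + expr_cost e2 + poly q k)"
    by (simp only: compile.simps) (intro ExQuery; simp)
  show "\<exists>s1 T. ex (compile (Ask e1 e2) l) s0 s1 T \<and> (\<forall>x<l. s1 x = s x) \<and> Q (s1 l)
      \<and> T \<le> poly (tpoly q (Ask e1 e2)) K"
    using * assms eq
    by (intro exI[of _ "s0(l := enc_mat (bb k As))"]
        exI[of _ "1 + expr_cost e1 + expr_cost e2 + poly q k"])
      (simp add: poly_nat_mono)
qed

text \<open>The invariant is indexed by the elements already consumed, so it can relate the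
  accumulator to their number or to their contents.\<close>

lemma res_Iter:
  assumes e: "evars e \<subseteq> {..<k}" "expr_val e s = enc_list xs" "length xs \<le> K"
    and a: "res a k s (I [])"
    and k': "k1 = k + 1" "k2 = k + 2" "k3 = k + 3"
    and b': "\<And>ys x zs v. xs = ys @ x # zs \<Longrightarrow> I ys v \<Longrightarrow>
       res b k3 (s(k := v, k1 := enc_list zs, k2 := x)) (I (ys @ [x]))"
  shows "res (Iter e a b) k s (I xs)"
proof (rule resI)
  note b = b'[unfolded k']
  fix s0 assume eq: "\<And>x. x < k \<Longrightarrow> s0 x = s x"
  define W where "W = While (Var (k + 1))
         (Seq (Assign (k + 2) (Hd (Var (k + 1))))
           (Seq (Assign (k + 1) (Tl (Var (k + 1))))
             (Seq (compile b (k + 3)) (Assign k (Var (k + 3))))))"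
  have loop: "\<exists>s2 T. ex W s1 s2 T \<and> (\<forall>x<k. s2 x = s x) \<and> I xs (s2 k)
      \<and> T \<le> 2 + length zs * (poly (tpoly q b) K + 10)"
    if "xs = ys @ zs" "I ys (s1 k)" "s1 (k + 1) = enc_list zs" "\<And>x. x < k \<Longrightarrow> s1 x = s x"
    for ys zs s1
    using that
  proof (induction zs arbitrary: ys s1)
    case Nil
    then show ?case
      using ExWhileF[of "Var (k + 1)" s1 n bb "poly q"]
      by (intro exI[of _ s1] exI[of _ 2]) (auto simp: W_def numeral_2_eq_2)
  next
    case (Cons x zs)
    define s2 where "s2 = s1(k + 2 := x)"
    define s3 where "s3 = s2(k + 1 := enc_list zs)"
    have 1: "ex (Assign (k + 2) (Hd (Var (k + 1)))) s1 s2 3"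
      using ExAssign[of n bb "poly q" "k + 2" "Hd (Var (k + 1))" s1] Cons.prems
      by (simp add: s2_def numeral_3_eq_3)
    have 2: "ex (Assign (k + 1) (Tl (Var (k + 1)))) s2 s3 3"
      using ExAssign[of n bb "poly q" "k + 1" "Tl (Var (k + 1))" s2] Cons.prems
      by (simp add: s3_def s2_def numeral_3_eq_3)
    have "\<And>y. y < k + 3 \<Longrightarrow> s3 y = (s(k := s1 k, k + 1 := enc_list zs, k + 2 := x)) y"
      using Cons.prems(4) by (auto simp: s3_def s2_def)
    with b[OF Cons.prems(1,2)] obtain s4 T where 4: "ex (compile b (k + 3)) s3 s4 T"
      "\<And>y. y < k + 3 \<Longrightarrow> s4 y = (s(k := s1 k, k + 1 := enc_list zs, k + 2 := x)) y"
      "I (ys @ [x]) (s4 (k + 3))" "T \<le> poly (tpoly q b) K"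
      by (rule resE) auto
    define s5 where "s5 = s4(k := s4 (k + 3))"
    have 5: "ex (Assign k (Var (k + 3))) s4 s5 2"
      using ExAssign[of n bb "poly q" "k" "Var (k + 3)" s4]
      by (simp add: s5_def numeral_2_eq_2)
    have "\<exists>s6 T. ex W s5 s6 T \<and> (\<forall>x<k. s6 x = s x) \<and> I xs (s6 k)
      \<and> T \<le> 2 + length zs * (poly (tpoly q b) K + 10)"
      using Cons.prems 4 by (intro Cons.IH[of "ys @ [x]"]) (auto simp: s5_def)
    then obtain s6 T' where 6: "ex W s5 s6 T'" "\<forall>x<k. s6 x = s x" "I xs (s6 k)"
      "T' \<le> 2 + length zs * (poly (tpoly q b) K + 10)"
      by blast
    \<comment> \<open>Besides its body, a round costs 2 for the test, 3 each for taking head and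
      tail, and 2 for copying the result: the 10 in \<open>tpoly\<close>.\<close>
    have "ex W s1 s6 (1 + expr_cost (Var (k + 1)) + (3 + (3 + (T + 2))) + T')"
      using Cons.prems(3) 6(1) unfolding W_def
      by (intro ExWhileT[OF _ ExSeq[OF 1 ExSeq[OF 2 ExSeq[OF 4(1) 5]]]]) auto
    then show ?case
      using 4 6 by (intro exI[of _ s6] exI conjI) auto
  qed
  from a eq obtain s1 T1 where 1: "ex (compile a k) s0 s1 T1" "\<And>x. x < k \<Longrightarrow> s1 x = s x"
    "I [] (s1 k)" "T1 \<le> poly (tpoly q a) K"
    by (rule resE) auto
  have "expr_val e s1 = expr_val e s"
    using e(1) 1(2) by (intro expr_val_cong) auto
  then have 2: "ex (Assign (k + 1) e) s1 (s1(k + 1 := enc_list xs)) (1 + expr_cost e)"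
    using ExAssign[of n bb "poly q" "k + 1" e s1] e(2) by simp
  obtain s2 T2 where 3: "ex W (s1(k + 1 := enc_list xs)) s2 T2" "\<forall>x<k. s2 x = s x"
    "I xs (s2 k)" "T2 \<le> 2 + length xs * (poly (tpoly q b) K + 10)"
    using loop[of "[]" xs "s1(k + 1 := enc_list xs)"] 1 by auto
  have "length xs * (poly (tpoly q b) K + 10) \<le> K * (poly (tpoly q b) K + 10)"
    using e(3) by (rule mult_right_mono) simp
  then have "T2 \<le> 2 + K * (poly (tpoly q b) K + 10)"
    using 3(4) by (meson add_left_mono order_trans)
  with 1(4) have "T1 + (1 + expr_cost e + T2) \<le> poly (tpoly q (Iter e a b)) K"
    by (simp add: algebra_simps)
  moreover have "ex (compile (Iter e a b) k) s0 s2 (T1 + (1 + expr_cost e + T2))"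
    using ExSeq[OF 1(1) ExSeq[OF 2 3(1)]] by (simp add: W_def)
  ultimately show "\<exists>s1 T. ex (compile (Iter e a b) k) s0 s1 T \<and> (\<forall>x<k. s1 x = s x) \<and> I xs (s1 k)
      \<and> T \<le> poly (tpoly q (Iter e a b)) K"
    using 3 by blast
qed

end

text \<open>Programs that only count can use any list as a counter. In this way the stored prefix
  serves as its own length in unary.\<close>

definition list_like :: "nat \<Rightarrow> 'a tree \<Rightarrow> bool" where
  "list_like m t \<longleftrightarrow> (\<exists>ts. t = enc_list ts \<and> length ts = m)"

lemma enc_nat_conv_list: "enc_nat a = enc_list (replicate a TNil)"
  by (induction a) auto

lemma list_like_nat [simp]: "list_like m (enc_nat a) \<longleftrightarrow> m = a"
  by (auto simp: list_like_def enc_nat_conv_list)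

lemma list_like_list [simp]: "list_like m (enc_list ts) \<longleftrightarrow> m = length ts"
  by (auto simp: list_like_def)

lemma tl_tree_enc_list [simp]: "tl_tree (enc_list ts) = enc_list (tl ts)"
  by (cases ts) auto

lemma tl_tree_list [simp]: "(tl_tree ^^ m) (enc_list ts) = enc_list (drop m ts)"
  by (induction m) (auto simp: drop_Suc tl_drop)

lemma tl_tree_nat [simp]: "(tl_tree ^^ m) (enc_nat a) = enc_nat (a - m)"
  by (simp add: enc_nat_conv_list)

lemma enc_list_eq_TNil [simp]: "enc_list ts = TNil \<longleftrightarrow> ts = []"
  by (cases ts) auto

lemma enc_nat_eq_TNil [simp]: "enc_nat a = TNil \<longleftrightarrow> a = 0"
  by (cases a) auto

lemma hd_tree_enc_list [simp]: "ts \<noteq> [] \<Longrightarrow> hd_tree (enc_list ts) = hd ts"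
  by (cases ts) auto

section \<open>Programs for lists and unary numbers\<close>

definition drop_tm :: "nat \<Rightarrow> nat \<Rightarrow> nat \<Rightarrow> tm" where
  "drop_tm k y x = Iter (Var y) (Ret (Var x)) (Ret (Tl (Var k)))"

definition add_tm :: "nat \<Rightarrow> nat \<Rightarrow> nat \<Rightarrow> tm" where
  "add_tm k y x = Iter (Var y) (Ret (Var x)) (Ret (ConsE NilE (Var k)))"

definition mult_tm :: "nat \<Rightarrow> nat \<Rightarrow> nat \<Rightarrow> tm" where
  "mult_tm k x y = Iter (Var x) (Ret NilE) (add_tm (k + 3) y k)"

definition rev_tm :: "nat \<Rightarrow> nat \<Rightarrow> tm" where
  "rev_tm k x = Iter (Var x) (Ret NilE) (Ret (ConsE (Var (k + 2)) (Var k)))"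

text \<open>Without a comparison of trees, two numbers are equal iff both truncated differences are
  zero.\<close>

definition eq_tm :: "nat \<Rightarrow> nat \<Rightarrow> nat \<Rightarrow> expr \<Rightarrow> expr \<Rightarrow> tm" where
  "eq_tm k x y e1 e2 =
     Bind (drop_tm k x y) (Bind (drop_tm (k + 1) y x)
       (Branch (Var k) (Ret e2) (Branch (Var (k + 1)) (Ret e2) (Ret e1))))"

text \<open>Counts up and resets to 0 on reaching the modulus. For modulus 0 the reset never
  happens, in agreement with \<open>x mod 0 = x\<close>.\<close>

definition mod_tm :: "nat \<Rightarrow> nat \<Rightarrow> nat \<Rightarrow> tm" where
  "mod_tm k x y = Iter (Var x) (Ret NilE)
     (Bind (Ret (ConsE NilE (Var k))) (eq_tm (k + 4) (k + 3) y NilE (Var (k + 3))))"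

text \<open>The index counts down while results are added in front, so the list comes out in
  increasing order without a reversal.\<close>

definition map_tm :: "nat \<Rightarrow> nat \<Rightarrow> tm \<Rightarrow> tm" where
  "map_tm k x b = Iter (Var x) (Ret NilE) (Bind b (Ret (ConsE (Var (k + 3)) (Var k))))"

context machine
begin

lemma res_Let:
  assumes "res a k s ((=) v)" "k' = Suc k" "res b k' (s(k := v)) Q"
  shows "res (Bind a b) k s Q"
  using assms by (auto intro: res_Bind)

lemma res_drop:
  assumes "x < k" "y < k" "list_like m (s y)" "m \<le> K" "Q ((tl_tree ^^ m) (s x))"
  shows "res (drop_tm k y x) k s Q"
proof -
  obtain ts where ts: "s y = enc_list ts" "length ts = m"
    using assms(3) by (auto simp: list_like_def)
  have "res (drop_tm k y x) k s ((\<lambda>us v. v = (tl_tree ^^ length us) (s x)) ts)"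
    unfolding drop_tm_def
    by (rule res_Iter[where xs = "ts" and
        I = "\<lambda>us v. v = (tl_tree ^^ length us) (s x)"])
      (use assms ts in \<open>auto intro!: res_Ret\<close>)
  then show ?thesis by (rule res_mono) (use assms ts in auto)
qed

lemma res_add:
  assumes "x < k" "y < k" "list_like m (s y)" "m \<le> K" "s x = enc_nat a" "Q (enc_nat (m + a))"
  shows "res (add_tm k y x) k s Q"
proof -
  obtain ts where ts: "s y = enc_list ts" "length ts = m"
    using assms(3) by (auto simp: list_like_def)
  have "res (add_tm k y x) k s ((\<lambda>us v. v = enc_nat (length us + a)) ts)"
    unfolding add_tm_def
    by (rule res_Iter[where xs = "ts" and
        I = "\<lambda>us v. v = enc_nat (length us + a)"])
      (use assms ts in \<open>auto intro!: res_Ret\<close>)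
  then show ?thesis by (rule res_mono) (use assms ts in auto)
qed

text \<open>For \<open>a = 0\<close> no addition is executed, so \<open>b\<close> needs a bound only
  for positive \<open>a\<close>. Evaluating a polynomial at 0 relies on this.\<close>

lemma res_mult:
  assumes "x < k" "y < k" "s x = enc_nat a" "s y = enc_nat b" "a \<le> K" "0 < a \<Longrightarrow> b \<le> K"
    and "Q (enc_nat (a * b))"
  shows "res (mult_tm k x y) k s Q"
proof -
  have "res (mult_tm k x y) k s ((\<lambda>us v. v = enc_nat (length us * b)) (replicate a (TNil :: 'a tree)))"
    unfolding mult_tm_def
  proof (rule res_Iter[where xs = "replicate a TNil" and I = "\<lambda>us v. v = enc_nat (length us * b)"
      and ?k1.0 = "k + 1" and ?k2.0 = "k + 2" and ?k3.0 = "k + 3"])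
    fix us zs :: "'a tree list" and z v :: "'a tree"
    assume "replicate a TNil = us @ z # zs"
    then have "0 < a" by (cases a) auto
    moreover assume "v = enc_nat (length us * b)"
    ultimately show "res (add_tm (k + 3) y k) (k + 3) (s(k := v, k + 1 := enc_list zs, k + 2 := z))
        (\<lambda>v. v = enc_nat (length (us @ [z]) * b))"
      using assms by (intro res_add[where m = b and a = "length us * b"]) auto
  qed (use assms in \<open>auto intro!: res_Ret simp: enc_nat_conv_list\<close>)
  then show ?thesis by (rule res_mono) (use assms in auto)
qed

lemma res_rev:
  assumes "x < k" "s x = enc_list ts" "length ts \<le> K" "Q (enc_list (rev ts))"
  shows "res (rev_tm k x) k s Q"
proof -
  have "res (rev_tm k x) k s ((\<lambda>us v. v = enc_list (rev us)) ts)"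
    unfolding rev_tm_def
    by (rule res_Iter[where xs = "ts" and
        I = "\<lambda>us v. v = enc_list (rev us)"])
      (use assms in \<open>auto intro!: res_Ret\<close>)
  then show ?thesis by (rule res_mono) (use assms in auto)
qed

lemma res_eq:
  assumes "x < k" "y < k" "s x = enc_nat a" "s y = enc_nat b" "a \<le> K" "b \<le> K"
    and "evars e1 \<subseteq> {..<k}" "evars e2 \<subseteq> {..<k}"
    and "Q (if a = b then expr_val e1 s else expr_val e2 s)"
  shows "res (eq_tm k x y e1 e2) k s Q"
proof -
  define s' where "s' = s(k := enc_nat (b - a), Suc k := enc_nat (a - b))"
  have "expr_val e1 s' = expr_val e1 s" "expr_val e2 s' = expr_val e2 s"
    using assms(7,8) by (intro expr_val_cong; force simp: s'_def)+
  then have "res (Branch (Var k) (Ret e2) (Branch (Var (Suc k)) (Ret e2) (Ret e1))) (Suc (Suc k)) s' Q"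
    using assms(7-) by (intro res_Branch res_Ret) (auto simp: s'_def split: if_splits)
  then have "res (Bind (drop_tm (Suc k) y x)
      (Branch (Var k) (Ret e2) (Branch (Var (Suc k)) (Ret e2) (Ret e1))))
      (Suc k) (s(k := enc_nat (b - a))) Q"
    using assms unfolding s'_def
    by - (rule res_Let[where k' = "Suc (Suc k)" and v = "enc_nat (a - b)"],
      rule res_drop[where m = b], auto)
  then show ?thesis
    using assms unfolding eq_tm_def
    by - (rule res_Let[where k' = "Suc k" and v = "enc_nat (b - a)"],
      rule res_drop[where m = a], auto)
qed

lemma res_mod:
  assumes "x < k" "y < k" "s x = enc_nat a" "s y = enc_nat b" "a \<le> K" "b \<le> K"
    and "Q (enc_nat (a mod b))"
  shows "res (mod_tm k x y) k s Q"
proof -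
  have "res (mod_tm k x y) k s ((\<lambda>us v. v = enc_nat (length us mod b)) (replicate a (TNil :: 'a tree)))"
    unfolding mod_tm_def
  proof (rule res_Iter[where xs = "replicate a TNil" and I = "\<lambda>us v. v = enc_nat (length us mod b)"
      and ?k1.0 = "k + 1" and ?k2.0 = "k + 2" and ?k3.0 = "k + 3"])
    fix us zs :: "'a tree list" and z v :: "'a tree"
    assume "replicate a TNil = us @ z # zs"
    then have "length (replicate a (TNil :: 'a tree)) = length (us @ z # zs)" by (simp only:)
    then have len: "Suc (length us) \<le> a" by simp
    have "length us mod b \<le> length us" by simp
    with len assms(5) have "Suc (length us mod b) \<le> K" by linarith
    moreover assume "v = enc_nat (length us mod b)"
    ultimately show "res (Bind (Ret (ConsE NilE (Var k))) (eq_tm (k + 4) (k + 3) y NilE (Var (k + 3))))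
        (k + 3) (s(k := v, k + 1 := enc_list zs, k + 2 := z))
        (\<lambda>v. v = enc_nat (length (us @ [z]) mod b))"
      using assms
      by (intro res_Let[where k' = "k + 4" and v = "enc_nat (Suc (length us mod b))"] res_Ret
            res_eq[where a = "Suc (length us mod b)" and b = b])
        (auto simp: mod_Suc)
  qed (use assms in \<open>auto intro!: res_Ret simp: enc_nat_conv_list\<close>)
  then show ?thesis by (rule res_mono) (use assms in auto)
qed

lemma res_map:
  assumes "x < k" "s x = enc_nat N" "N \<le> K" "k1 = k + 1" "k2 = k + 2" "k3 = k + 3"
    and b: "\<And>i v z. i < N \<Longrightarrow> res b k3 (s(k := v, k1 := enc_nat i, k2 := z)) ((=) (g i))"
    and Q: "Q (enc_list (map g [0..<N]))"
  shows "res (map_tm k x b) k s Q"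
proof -
  have "res (map_tm k x b) k s
      ((\<lambda>us v. v = enc_list (map g [N - length us..<N])) (replicate N (TNil :: 'a tree)))"
    unfolding map_tm_def
  proof (rule res_Iter[where xs = "replicate N TNil" and I = "\<lambda>us v. v = enc_list (map g [N - length us..<N])"
      and ?k1.0 = "k + 1" and ?k2.0 = "k + 2" and ?k3.0 = "k + 3"])
    fix us zs :: "'a tree list" and z v :: "'a tree"
    assume eq: "replicate N TNil = us @ z # zs"
    then have "length (replicate N (TNil :: 'a tree)) = length (us @ z # zs)" by (simp only:)
    then have len: "length us < N" "length zs = N - Suc (length us)" by simp_all
    \<comment> \<open>All entries are \<open>TNil\<close>, so the remaining list is itself the loop
      index in unary.\<close>
    have "zs = drop (Suc (length us)) (replicate N TNil)" unfolding eq by simp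
    then have zs: "enc_list zs = enc_nat (N - Suc (length us))"
      by (simp add: enc_nat_conv_list)
    assume "v = enc_list (map g [N - length us..<N])"
    moreover have "[N - length (us @ [z])..<N] = (N - Suc (length us)) # [N - length us..<N]"
      using len by (simp add: upt_conv_Cons Suc_diff_Suc)
    ultimately show "res (Bind b (Ret (ConsE (Var (k + 3)) (Var k)))) (k + 3)
        (s(k := v, k + 1 := enc_list zs, k + 2 := z))
        (\<lambda>v. v = enc_list (map g [N - length (us @ [z])..<N]))"
      using len b[of "N - Suc (length us)" v z] assms(4-6) zs
      by (intro res_Let[where k' = "k + 4" and v = "g (N - Suc (length us))"] res_Ret) auto
  qed (use assms in \<open>auto intro!: res_Ret simp: enc_nat_conv_list\<close>)
  then show ?thesis by (rule res_mono) (use Q in auto)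
qed

end

subsection \<open>Querying the automata\<close>

text \<open>
  Fixed variables: 1, 2, 3 hold \<open>n\<close>, \<open>d\<close>, \<open>t\<close>; 6 the bound for the moduli; 14 the prefix \<open>u\<close>; 16 the
  modulus \<open>m\<close>; 19 the dimension; 21 the letter, 24 the row and 28 the column of the current entry.
  The levels at which these programs run are those of the lemmas \<open>res_step\<close>, \<open>res_mats\<close>, \<dots> below.
\<close>

definition step_tm :: tm where
  "step_tm =
     Bind (drop_tm 26 24 14)
       (Branch (Var 26)
         (Bind (Ret (Hd (Var 26)))
           (eq_tm 28 27 21 (ConsE NilE (Var 24)) (Var 19)))
         (Bind (drop_tm 27 14 24)
           (Bind (Ret (ConsE NilE (Var 1)))
             (Bind (mult_tm 29 27 28)
               (Bind (add_tm 30 21 29)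
                 (Bind (Ret (ConsE NilE (Var 30)))
                   (Bind (mod_tm 32 31 16)
                     (add_tm 33 14 32))))))))"

definition entry_tm :: tm where
  "entry_tm = eq_tm 30 26 28 OneF ZeroF"

definition row_tm :: tm where
  "row_tm = Bind step_tm (map_tm 27 19 entry_tm)"

definition mats_tm :: tm where
  "mats_tm = map_tm 20 1 (map_tm 23 19 row_tm)"

text \<open>Runs start in state 0, so only the first row is read; the dropped columns belong to the
  states that still spell \<open>u\<close>.\<close>

definition values_tm :: tm where
  "values_tm =
     Bind (Ret (ConsE NilE (Var 16)))
       (Bind (add_tm 19 14 18)
         (Bind mats_tm
           (Bind (Ask (Var 19) (Var 20))
             (Bind (Ret (Hd (Var 21)))
               (drop_tm 23 14 22)))))"

text \<open>
  The index \<open>m\<close> counts down, so after the last iteration, with \<open>m = 0\<close>, the second component is the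
  coefficient of \<open>u\<close>.
\<close>

definition probe_tm :: tm where
  "probe_tm =
     Iter (Var 6) (Ret NilE)
       (Bind values_tm
         (Bind
           (Iter (Var 18) (Ret (Hd (Var 15)))
             (Branch (IsZeroF (Var 21)) (Ret (Var 19)) (Ret OneF)))
           (Ret (ConsE (Var 19) (Hd (Var 18))))))"

lemma enc_mat_mat:
  "enc_mat (mat k l f) = enc_list (map (\<lambda>r. enc_list (map (\<lambda>c. TLeaf (f (r, c))) [0..<l])) [0..<k])"
  by (auto simp: enc_mat_def mat_to_list_def comp_def)

text \<open>This number is written out in unary before it is reduced modulo \<open>m\<close>, so its
  size enters the bound \<open>K\<close>.\<close>

lemma step_arg_le:
  assumes "i < n" "r \<le> l + m"
  shows "Suc (i + (r - l) * Suc n) \<le> Suc m * Suc n"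
proof -
  have "(r - l) * Suc n \<le> m * Suc n" using assms(2) by (intro mult_right_mono) auto
  then have "Suc i + (r - l) * Suc n \<le> Suc n + m * Suc n" using assms(1) by (intro add_mono) auto
  then show ?thesis by (simp only: add_Suc mult_Suc)
qed

text \<open>For \<open>m = 0\<close> the target is not reduced and may lie well beyond the
  dimension, yet the program still compares it with every column.\<close>

lemma step_le:
  assumes "i < n" "r \<le> length u + m"
  shows "step n u m r i \<le> Suc (length u + m) * Suc n"
proof -
  have "Suc (i + (r - length u) * Suc n) mod m \<le> Suc m * Suc n"
    using step_arg_le[OF assms] mod_less_eq_dividend order_trans by blast
  moreover have "length u \<le> length u * Suc n" by simp
  ultimately have "length u + Suc (i + (r - length u) * Suc n) mod m \<le> Suc (length u + m) * Suc n"
    unfolding mult_Suc add_mult_distrib by linarith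
  then show ?thesis using assms unfolding step_def by auto
qed

context machine
begin

lemma res_step:
  assumes s: "s 1 = enc_nat n" "s 14 = enc_list (map enc_nat u)" "s 16 = enc_nat m"
      "s 19 = enc_nat (Suc (length u + m))" "s 21 = enc_nat i" "s 24 = enc_nat r"
    and u: "set u \<subseteq> {..<n}" and ir: "i < n" "r \<le> length u + m"
    and K: "Suc (length u + m) * Suc n \<le> K"
  shows "res step_tm 26 s ((=) (enc_nat (step n u m r i)))"
proof -
  let ?h = "r - length u"
  let ?c = "Suc (i + ?h * Suc n)"
  have "Suc m * Suc n \<le> Suc (length u + m) * Suc n" by (intro mult_right_mono) auto
  then have "?c \<le> K" using step_arg_le[OF ir] K by (meson order_trans)
  then have bounds: "Suc n \<le> K" "Suc (length u + m) \<le> K" "?c \<le> K" using K by simp_all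
  have "res step_tm 26 s ((=) (enc_nat (step n u m r i)))" if "r < length u"
  proof -
    have "u ! r \<le> K" using u that bounds nth_mem[OF that] by fastforce
    with that show ?thesis
      using s ir bounds unfolding step_tm_def
      apply -
      \<comment> \<open>The remainder of \<open>u\<close> after \<open>r\<close> letters decides by
        its emptiness whether \<open>r < length u\<close>, and its head is
        \<open>u ! r\<close>.\<close>
      apply (rule res_Let[where k' = 27 and v = "enc_list (drop r (map enc_nat u))"])
        apply (rule res_drop[where m = r]; simp)
       apply simp
      apply (rule res_Branch)
        apply simp
       apply (rule res_Let[where k' = 28 and v = "enc_nat (u ! r)"])
         apply (rule res_Ret; simp add: hd_drop_conv_nth)
        apply simp
       \<comment> \<open>On a mismatch the target is the dimension in variable 19, the first number
         that is not a state.\<close>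
       apply (rule res_eq[where a = "u ! r" and b = i]; simp add: step_def)
      apply simp
      done
  qed
  moreover have "res step_tm 26 s ((=) (enc_nat (step n u m r i)))" if "\<not> r < length u"
    using that s ir bounds unfolding step_tm_def
    apply -
    apply (rule res_Let[where k' = 27 and v = "enc_list (drop r (map enc_nat u))"])
      apply (rule res_drop[where m = r]; simp)
     apply simp
    apply (rule res_Branch)
      apply simp
     apply simp
    apply (rule res_Let[where k' = 28 and v = "enc_nat ?h"])
      apply (rule res_drop[where m = "length u"]; simp)
     apply simp
    apply (rule res_Let[where k' = 29 and v = "enc_nat (Suc n)"])
      apply (rule res_Ret; simp)
     apply simp
    apply (rule res_Let[where k' = 30 and v = "enc_nat (?h * Suc n)"])
      apply (rule res_mult[where a = ?h and b = "Suc n"]; simp)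
     apply simp
    apply (rule res_Let[where k' = 31 and v = "enc_nat (i + ?h * Suc n)"])
      apply (rule res_add[where m = i and a = "?h * Suc n"]; simp)
     apply simp
    apply (rule res_Let[where k' = 32 and v = "enc_nat ?c"])
      apply (rule res_Ret; simp)
     apply simp
    apply (rule res_Let[where k' = 33 and v = "enc_nat (?c mod m)"])
      apply (rule res_mod[where a = ?c and b = m]; simp)
     apply simp
    apply (rule res_add[where m = "length u" and a = "?c mod m"]; simp add: step_def)
    done
  ultimately show ?thesis by blast
qed

lemma res_mats:
  assumes s: "s 1 = enc_nat n" "s 14 = enc_list (map enc_nat u)" "s 16 = enc_nat m"
      "s 19 = enc_nat (Suc (length u + m))"
    and u: "set u \<subseteq> {..<n}"
    and K: "Suc (length u + m) * Suc n \<le> K"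
  shows "res mats_tm 20 s ((=) (enc_list (map enc_mat (step_mats n u m))))"
proof -
  let ?k = "Suc (length u + m)"
  let ?e = "\<lambda>i r c. TLeaf (if step n u m r i = c then 1 else 0)"
  let ?row = "\<lambda>i r. enc_list (map (?e i r) [0..<?k])"
  have bounds: "n \<le> K" "?k \<le> K" using K by simp_all
  have row: "res row_tm 26 s ((=) (?row i r))"
    if s: "s 1 = enc_nat n" "s 14 = enc_list (map enc_nat u)" "s 16 = enc_nat m"
      "s 19 = enc_nat ?k" "s 21 = enc_nat i" "s 24 = enc_nat r"
      and ir: "i < n" "r < ?k" for s i r
    unfolding row_tm_def
    apply (rule res_Let[where k' = 27 and v = "enc_nat (step n u m r i)"])
      apply (rule res_step; use s u ir K in simp)
     apply simp
    apply (rule res_map[where N = ?k and ?k1.0 = 28 and ?k2.0 = 29 and ?k3.0 = 30 and g = "?e i r"])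
    using s bounds apply simp_all[6]
     apply (unfold entry_tm_def)
    subgoal for c
      by (rule res_eq[where a = "step n u m r i" and b = c]) (use ir bounds order_trans[OF step_le K] in auto)
    apply simp
    done
  have "res mats_tm 20 s ((=) (enc_list (map (\<lambda>i. enc_list (map (?row i) [0..<?k])) [0..<n])))"
    unfolding mats_tm_def
    apply (rule res_map[where N = n and ?k1.0 = 21 and ?k2.0 = 22 and ?k3.0 = 23
          and g = "\<lambda>i. enc_list (map (?row i) [0..<?k])"])
    using s bounds apply simp_all[6]
    subgoal for i
      apply (rule res_map[where N = ?k and ?k1.0 = 24 and ?k2.0 = 25 and ?k3.0 = 26 and g = "?row i"])
      using s bounds apply simp_all[6]
       apply (rule row; use s in simp)
      apply (rule refl)
      done
    apply (rule refl)
    done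
  then show ?thesis
    by (simp add: step_mats_def enc_mat_mat comp_def del: upt_Suc)
qed

lemma res_values:
  assumes s: "s 1 = enc_nat n" "s 14 = enc_list (map enc_nat u)" "s 16 = enc_nat m"
    and u: "set u \<subseteq> {..<n}"
    and K: "Suc (length u + m) * Suc n \<le> K"
    and bb: "bb (Suc (length u + m)) (step_mats n u m) \<in> carrier_mat (Suc (length u + m)) (Suc (length u + m))"
  shows "res values_tm 18 s ((=) (enc_list
    (map (\<lambda>j. TLeaf (bb (Suc (length u + m)) (step_mats n u m) $$ (0, length u + j))) [0..<Suc m])))"
proof -
  let ?k = "Suc (length u + m)"
  let ?B = "bb ?k (step_mats n u m)"
  let ?row = "enc_list (map (\<lambda>c. TLeaf (?B $$ (0, c))) [0..<?k])"
  have bounds: "length u \<le> K" "?k \<le> K" using K by simp_all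
  have "mat_to_list ?B = map (\<lambda>r. map (\<lambda>c. ?B $$ (r, c)) [0..<?k]) [0..<?k]"
    using bb unfolding mat_to_list_def by (simp del: upt_Suc)
  then have "hd_tree (enc_mat ?B) = ?row"
    by (simp add: enc_mat_def upt_conv_Cons comp_def del: upt_Suc)
  moreover have "drop (length u) (map (\<lambda>c. TLeaf (?B $$ (0, c))) [0..<?k])
      = map (\<lambda>j. TLeaf (?B $$ (0, length u + j))) [0..<Suc m]"
    by (rule nth_equalityI) (auto simp del: upt_Suc)
  ultimately show ?thesis
    unfolding values_tm_def
    using s bounds
    apply -
    apply (rule res_Let[where k' = 19 and v = "enc_nat (Suc m)"])
      apply (rule res_Ret; simp)
     apply simp
    apply (rule res_Let[where k' = 20 and v = "enc_nat ?k"])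
      apply (rule res_add[where m = "length u" and a = "Suc m"]; simp)
     apply simp
    apply (rule res_Let[where k' = 21 and v = "enc_list (map enc_mat (step_mats n u m))"])
      apply (rule res_mats[OF _ _ _ _ u K]; simp)
     apply simp
    apply (rule res_Let[where k' = 22 and v = "enc_mat ?B"])
      apply (rule res_Ask[where k = ?k and As = "step_mats n u m"];
        simp del: enc_nat.simps; auto simp: step_mats_def)
     apply simp
    apply (rule res_Let[where k' = 23 and v = ?row])
      apply (rule res_Ret; simp del: upt_Suc)
     apply simp
    apply (rule res_drop[where m = "length u"]; simp del: upt_Suc)
    done
qed

lemma res_probe:
  fixes u :: "nat list" and M :: nat
  defines "val \<equiv> \<lambda>m j. bb (Suc (length u + m)) (step_mats n u m) $$ (0, length u + j)"
  assumes s: "s 1 = enc_nat n" "s 6 = enc_nat M" "s 14 = enc_list (map enc_nat u)"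
    and u: "set u \<subseteq> {..<n}" and M: "0 < M"
    and K: "Suc (length u + M) * Suc n \<le> K"
    and bb: "\<And>k As. bb k As \<in> carrier_mat k k"
  shows "res probe_tm 15 s
    (\<lambda>v. \<exists>b. v = TNode b (TLeaf (val 0 0)) \<and> (b \<noteq> TNil \<longleftrightarrow> (\<exists>m<M. \<exists>j\<le>m. val m j \<noteq> 0)))"
proof -
  \<comment> \<open>The initial \<open>NilE\<close> has head \<open>TNil\<close>, a lowered flag.
    The second component is overwritten in every round, so it is constrained only once all moduli
    are done.\<close>
  define I where "I us v \<longleftrightarrow>
      (hd_tree v \<noteq> TNil \<longleftrightarrow> (\<exists>m<M. M - length us \<le> m \<and> (\<exists>j\<le>m. val m j \<noteq> 0))) \<and>
      (length us = M \<longrightarrow> (\<exists>b. v = TNode b (TLeaf (val 0 0))))" for us :: "'a tree list" and v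
  have MK: "M \<le> K" using K by simp
  have "res probe_tm 15 s (I (replicate M TNil))"
    unfolding probe_tm_def
  proof (rule res_Iter[where ?k1.0 = 16 and ?k2.0 = 17 and ?k3.0 = 18])
    fix us zs :: "'a tree list" and z v
    assume eq: "replicate M TNil = us @ z # zs" and I: "I us v"
    then have "length (replicate M (TNil :: 'a tree)) = length (us @ z # zs)" by (simp only:)
    then have len: "length us < M" "length zs = M - Suc (length us)" by simp_all
    define m where "m = M - Suc (length us)"
    have "zs = drop (Suc (length us)) (replicate M TNil)" unfolding eq by simp
    then have zs: "enc_list zs = enc_nat m"
      by (simp add: enc_nat_conv_list m_def)
    have "m < M" using len by (simp add: m_def)
    then have "Suc (length u + m) * Suc n \<le> Suc (length u + M) * Suc n"
      by (intro mult_right_mono) auto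
    with K have Km: "Suc (length u + m) * Suc n \<le> K" by (rule order_trans[rotated])
    have mK: "Suc m \<le> K" using \<open>m < M\<close> MK by simp
    let ?vs = "map (\<lambda>j. TLeaf (val m j)) [0..<Suc m]"
    let ?s = "s(15 := v, 16 := enc_nat m, 17 := z)"
    let ?s' = "?s(18 := enc_list ?vs)"
    have hd_vs: "hd ?vs = TLeaf (val m 0)" by (simp add: upt_conv_Cons del: upt_Suc)
    have vals: "res values_tm 18 ?s ((=) (enc_list ?vs))"
      unfolding val_def using s by (intro res_values[OF _ _ _ u Km bb]) auto
    have flag: "res (Iter (Var 18) (Ret (Hd (Var 15)))
        (Branch (IsZeroF (Var 21)) (Ret (Var 19)) (Ret OneF))) 19 ?s'
        (\<lambda>b. b \<noteq> TNil \<longleftrightarrow> hd_tree v \<noteq> TNil \<or> (\<exists>x \<in> set ?vs. x \<noteq> TLeaf 0))"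
      by (rule res_Iter[where xs = ?vs and ?k1.0 = 20 and ?k2.0 = 21 and ?k3.0 = 22 and
            I = "\<lambda>us b. b \<noteq> TNil \<longleftrightarrow> hd_tree v \<noteq> TNil \<or> (\<exists>x \<in> set us. x \<noteq> TLeaf 0)"])
        (use mK in \<open>auto intro!: res_Ret res_Branch simp del: upt_Suc split: if_splits\<close>)
    have interval: "(\<exists>m'<M. M - length (us @ [z]) \<le> m' \<and> P m') \<longleftrightarrow>
        (\<exists>m'<M. M - length us \<le> m' \<and> P m') \<or> P m" for P
    proof -
      have "M - length (us @ [z]) \<le> m' \<longleftrightarrow> M - length us \<le> m' \<or> m' = m" for m'
        using len by (auto simp: m_def)
      then show ?thesis using \<open>m < M\<close> by auto
    qed
    have "res (Bind values_tm (Bind (Iter (Var 18) (Ret (Hd (Var 15)))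
        (Branch (IsZeroF (Var 21)) (Ret (Var 19)) (Ret OneF))) (Ret (ConsE (Var 19) (Hd (Var 18))))))
        18 ?s (I (us @ [z]))"
    proof (rule res_Let[OF vals, where k' = 19], simp, rule res_Bind[OF flag, where k' = 20], simp)
      fix b :: "'a tree"
      assume b: "b \<noteq> TNil \<longleftrightarrow> hd_tree v \<noteq> TNil \<or> (\<exists>x \<in> set ?vs. x \<noteq> TLeaf 0)"
      have "(\<exists>x \<in> set ?vs. x \<noteq> TLeaf 0) \<longleftrightarrow> (\<exists>j\<le>m. val m j \<noteq> 0)"
        by (auto simp: less_Suc_eq_le simp del: upt_Suc)
      then have "I (us @ [z]) (TNode b (TLeaf (val m 0)))"
        using I b len unfolding I_def interval by (auto simp: m_def)
      then show "res (Ret (ConsE (Var 19) (Hd (Var 18)))) 20 (?s'(19 := b)) (I (us @ [z]))"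
        by (intro res_Ret) (auto simp: hd_vs simp del: upt_Suc)
    qed
    then show "res (Bind values_tm (Bind (Iter (Var 18) (Ret (Hd (Var 15)))
        (Branch (IsZeroF (Var 21)) (Ret (Var 19)) (Ret OneF))) (Ret (ConsE (Var 19) (Hd (Var 18))))))
        18 (s(15 := v, 16 := enc_list zs, 17 := z)) (I (us @ [z]))"
      by (simp only: zs)
  qed (use s MK M in \<open>auto intro!: res_Ret simp: I_def enc_nat_conv_list\<close>)
  then show ?thesis by (rule res_mono) (use M in \<open>fastforce simp: I_def\<close>)
qed

end

subsection \<open>Breadth-first search over prefixes\<close>

text \<open>
  Words of the frontier are stored reversed, in variable 13 the current one; variables 8 and 11 hold
  pairs of a frontier and the list of terms found so far.
\<close>

definition visit_tm :: tm where
  "visit_tm =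
     Bind (rev_tm 14 13)
       (Bind probe_tm
         (Branch (Hd (Var 15))
           (Bind (Iter (Var 1) (Ret (Hd (Var 11))) (Ret (ConsE (ConsE (Var 17) (Var 13)) (Var 16))))
             (Branch (IsZeroF (Tl (Var 15)))
               (Ret (ConsE (Var 16) (Tl (Var 11))))
               (Ret (ConsE (Var 16) (ConsE (ConsE (Var 14) (Tl (Var 15))) (Tl (Var 11)))))))
           (Ret (Var 11))))"

definition level_tm :: tm where
  "level_tm = Iter (Hd (Var 8)) (Ret (ConsE NilE (Tl (Var 8)))) visit_tm"

text \<open>There are \<open>d + 1\<close> rounds, one for each length from 0 to \<open>d\<close>;
  the search starts from the empty word and no terms.\<close>

definition search_tm :: tm where
  "search_tm =
     Bind (Ret (ConsE NilE (Var 2)))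
       (Bind (Iter (Var 7) (Ret (ConsE (ConsE NilE NilE) NilE)) level_tm)
         (Ret (Tl (Var 8))))"

definition main_tm :: tm where
  "main_tm =
     Bind (mult_tm 4 1 2)
       (Bind (mult_tm 5 4 3)
         (Bind (Ret (ConsE NilE (ConsE NilE (ConsE NilE (Var 5))))) search_tm))"

text \<open>Reversed storage makes appending a letter a single \<open>ConsE\<close>.\<close>

definition enc_frontier :: "nat list list \<Rightarrow> 'a tree" where
  "enc_frontier us = enc_list (map (\<lambda>u. enc_list (map enc_nat (rev u))) us)"

definition enc_terms :: "'a::zero ncpoly \<Rightarrow> nat list list \<Rightarrow> 'a tree" where
  "enc_terms f ws =
     enc_list (map (\<lambda>w. TNode (enc_list (map enc_nat w)) (TLeaf (Poly_Mapping.lookup f w))) ws)"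

definition extensions :: "nat \<Rightarrow> nat list list \<Rightarrow> nat list list" where
  "extensions n us = concat (map (\<lambda>u. map (\<lambda>i. u @ [i]) [0..<n]) us)"

lemma set_extensions: "set (extensions n us) = {u @ [i] |u i. u \<in> set us \<and> i < n}"
  by (auto simp: extensions_def)

lemma distinct_extensions: "distinct us \<Longrightarrow> distinct (extensions n us)"
  by (induction us) (auto simp: extensions_def distinct_map inj_on_def)

text \<open>\<open>K_probe\<close> covers the query dimensions and the numbers formed in
  \<open>step_tm\<close>, \<open>K_frontier\<close> the loop over one level, and
  \<open>K_terms\<close> the products that yield the bound for the moduli.\<close>

locale black_box = machine n "nc_eval f" q K
  for n :: nat and f :: "'a::field ncpoly" and q :: "nat poly" and K :: nat +
  fixes d t :: nat
  assumes f: "f \<in> ncpolys n" and deg: "nc_degree f \<le> d"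
    and card: "card (Poly_Mapping.keys f) \<le> t"
    and K_probe: "Suc (d + (n * d * t + 3)) * Suc n \<le> K" and K_frontier: "Suc (n * t) \<le> K"
    and K_terms: "n * d \<le> K" "t \<le> K"
begin

definition is_prefix :: "nat list \<Rightarrow> bool" where
  "is_prefix u \<longleftrightarrow> (\<exists>v. u @ v \<in> Poly_Mapping.keys f)"

lemma keys_is_prefix: "w \<in> Poly_Mapping.keys f \<Longrightarrow> is_prefix w"
  unfolding is_prefix_def by (metis append_Nil2)

lemma nd_le: "Suc n \<le> K" "Suc d \<le> K"
  using K_probe by (simp_all add: add_mult_distrib)

lemma keysD:
  assumes "w \<in> Poly_Mapping.keys f"
  shows "set w \<subseteq> {..<n}" "length w \<le> d"
proof -
  show "set w \<subseteq> {..<n}" using f assms unfolding ncpolys_def by blast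
  have "length w \<le> nc_degree f"
    using assms unfolding nc_degree_def by (intro Max_ge) auto
  with deg show "length w \<le> d" by simp
qed

text \<open>Filtering the singleton \<open>[u]\<close> expresses all outcomes of a visit at once and
  lets a level be assembled by concatenation.\<close>

lemma res_visit:
  assumes s: "s 1 = enc_nat n" "s 6 = enc_nat (n * d * t + 3)"
      "s 11 = TNode (enc_frontier F) (enc_terms f ws)" "s 13 = enc_list (map enc_nat (rev u))"
    and u: "set u \<subseteq> {..<n}" "length u \<le> d"
  shows "res visit_tm 14 s ((=) (TNode
    (enc_frontier (extensions n (filter is_prefix [u]) @ F))
    (enc_terms f (filter (\<lambda>w. w \<in> Poly_Mapping.keys f) [u] @ ws))))"
    (is "res _ _ _ ((=) ?v)")
proof -
  let ?M = "n * d * t + 3" and ?u = "enc_list (map enc_nat u)"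
  let ?F' = "enc_frontier (map (\<lambda>i. u @ [i]) [0..<n] @ F)"
  have coeff: "nc_eval f (Suc (length u + 0)) (step_mats n u 0) $$ (0, length u + 0)
      = Poly_Mapping.lookup f u"
    using prefix_value_0[OF f, of u] by (simp add: prefix_value_def)
  have K: "Suc (length u + ?M) * Suc n \<le> K"
  proof -
    have "Suc (length u + ?M) * Suc n \<le> Suc (d + ?M) * Suc n"
      using u(2) by (intro mult_right_mono) auto
    with K_probe show ?thesis by (rule order_trans[rotated])
  qed
  have probe: "res probe_tm 15 (s(14 := ?u))
      (\<lambda>v. \<exists>b. v = TNode b (TLeaf (Poly_Mapping.lookup f u)) \<and> (b \<noteq> TNil \<longleftrightarrow> is_prefix u))"
  proof (rule res_mono[OF res_probe[where M = ?M and u = u]])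
    show "nc_eval f k As \<in> carrier_mat k k" for k As by (simp add: nc_eval_def)
  next
    fix v
    assume "\<exists>b. v = TNode b (TLeaf (nc_eval f (Suc (length u + 0)) (step_mats n u 0) $$ (0, length u + 0))) \<and>
        (b \<noteq> TNil \<longleftrightarrow> (\<exists>m<?M. \<exists>j\<le>m. nc_eval f (Suc (length u + m)) (step_mats n u m) $$
          (0, length u + j) \<noteq> 0))"
    then show "\<exists>b. v = TNode b (TLeaf (Poly_Mapping.lookup f u)) \<and> (b \<noteq> TNil \<longleftrightarrow> is_prefix u)"
      unfolding coeff is_prefix_def live_iff_prefix[OF f deg card, symmetric] live_def prefix_value_def .
  qed (use s u K in auto)
  show ?thesis
    unfolding visit_tm_def
  proof (rule res_Let[where k' = 15 and v = ?u], rule res_rev[where ts = "map enc_nat (rev u)"])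
    show "res (Bind probe_tm
         (Branch (Hd (Var 15))
           (Bind (Iter (Var 1) (Ret (Hd (Var 11))) (Ret (ConsE (ConsE (Var 17) (Var 13)) (Var 16))))
             (Branch (IsZeroF (Tl (Var 15)))
               (Ret (ConsE (Var 16) (Tl (Var 11))))
               (Ret (ConsE (Var 16) (ConsE (ConsE (Var 14) (Tl (Var 15))) (Tl (Var 11)))))))
           (Ret (Var 11)))) 15 (s(14 := ?u)) ((=) ?v)"
    proof (rule res_Bind[OF probe, where k' = 16], simp, rule res_Branch)
      fix v
      assume "\<exists>b. v = TNode b (TLeaf (Poly_Mapping.lookup f u)) \<and> (b \<noteq> TNil \<longleftrightarrow> is_prefix u)"
      then obtain b where v: "v = TNode b (TLeaf (Poly_Mapping.lookup f u))"
        and b: "b \<noteq> TNil \<longleftrightarrow> is_prefix u" by blast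
      let ?s = "s(14 := ?u, 15 := v)"
      show "evars (Hd (Var 15)) \<subseteq> {..<16}" by simp
      {
        assume "expr_val (Hd (Var 15)) ?s \<noteq> TNil"
        then have pre: "is_prefix u" using b v by simp
        have ext: "res (Iter (Var 1) (Ret (Hd (Var 11))) (Ret (ConsE (ConsE (Var 17) (Var 13)) (Var 16))))
            16 ?s ((=) ?F')"
        proof -
          have "res (Iter (Var 1) (Ret (Hd (Var 11))) (Ret (ConsE (ConsE (Var 17) (Var 13)) (Var 16))))
              16 ?s ((\<lambda>us v. v = enc_frontier (map (\<lambda>i. u @ [i]) [n - length us..<n] @ F))
                (replicate n (TNil :: 'a tree)))"
          proof (rule res_Iter[where ?k1.0 = 17 and ?k2.0 = 18 and ?k3.0 = 19 and
                xs = "replicate n TNil" and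
                I = "\<lambda>us v. v = enc_frontier (map (\<lambda>i. u @ [i]) [n - length us..<n] @ F)"])
            fix us zs :: "'a tree list" and z v :: "'a tree"
            assume eq: "replicate n TNil = us @ z # zs"
            then have "length (replicate n (TNil :: 'a tree)) = length (us @ z # zs)" by (simp only:)
            then have len: "length us < n" "length zs = n - Suc (length us)" by simp_all
            have "zs = drop (Suc (length us)) (replicate n TNil)" unfolding eq by simp
            then have zs: "enc_list zs = enc_nat (n - Suc (length us))"
              by (simp add: enc_nat_conv_list)
            assume "v = enc_frontier (map (\<lambda>i. u @ [i]) [n - length us..<n] @ F)"
            moreover have "[n - length (us @ [z])..<n] = (n - Suc (length us)) # [n - length us..<n]"
              using len by (simp add: upt_conv_Cons Suc_diff_Suc)
            ultimately show "res (Ret (ConsE (ConsE (Var 17) (Var 13)) (Var 16))) 19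
                (?s(16 := v, 17 := enc_list zs, 18 := z))
                (\<lambda>v. v = enc_frontier (map (\<lambda>i. u @ [i]) [n - length (us @ [z])..<n] @ F))"
              using s zs by (intro res_Ret) (auto simp: enc_frontier_def)
          qed (use s nd_le in \<open>auto intro!: res_Ret simp: enc_nat_conv_list\<close>)
          then show ?thesis by (rule res_mono) simp
        qed
        show "res (Bind (Iter (Var 1) (Ret (Hd (Var 11))) (Ret (ConsE (ConsE (Var 17) (Var 13)) (Var 16))))
             (Branch (IsZeroF (Tl (Var 15)))
               (Ret (ConsE (Var 16) (Tl (Var 11))))
               (Ret (ConsE (Var 16) (ConsE (ConsE (Var 14) (Tl (Var 15))) (Tl (Var 11))))))) 16 ?s ((=) ?v)"
          using s v pre
          by (intro res_Let[OF ext, where k' = 17] res_Branch res_Ret)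
            (auto simp: extensions_def enc_terms_def in_keys_iff split: if_splits)
      next
        assume "expr_val (Hd (Var 15)) ?s = TNil"
        then have "\<not> is_prefix u" using b v by simp
        moreover from this have "u \<notin> Poly_Mapping.keys f"
          using keys_is_prefix by blast
        ultimately show "res (Ret (Var 11)) 16 ?s ((=) ?v)"
          using s by (intro res_Ret) (auto simp: extensions_def)
      }
    qed
  qed (use s u nd_le in \<open>auto simp: rev_map\<close>)
qed

lemma res_level:
  assumes s: "s 1 = enc_nat n" "s 6 = enc_nat (n * d * t + 3)"
      "s 8 = TNode (enc_frontier F) (enc_terms f ws)"
    and F: "\<And>u. u \<in> set F \<Longrightarrow> set u \<subseteq> {..<n} \<and> length u \<le> d" "length F \<le> K"
  shows "res level_tm 11 s ((=) (TNode
    (enc_frontier (extensions n (rev (filter is_prefix F))))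
    (enc_terms f (rev (filter (\<lambda>w. w \<in> Poly_Mapping.keys f) F) @ ws))))"
proof -
  define enc :: "nat list \<Rightarrow> 'a tree" where "enc u = enc_list (map enc_nat (rev u))" for u
  \<comment> \<open>The loop sees encoded words only, so the invariant asks for words
    \<open>G\<close> behind them; injectivity of \<open>enc\<close> identifies \<open>G\<close> with
    \<open>F\<close> at the end.\<close>
  define I where "I us v \<longleftrightarrow> (\<exists>G. us = map enc G \<and> (\<exists>G'. F = G @ G') \<and> v = TNode
    (enc_frontier (extensions n (rev (filter is_prefix G))))
    (enc_terms f (rev (filter (\<lambda>w. w \<in> Poly_Mapping.keys f) G) @ ws)))" for us and v :: "'a tree"
  have "inj (enc_nat :: nat \<Rightarrow> 'a tree)" by (auto intro: injI)
  then have inj: "enc u = enc v \<longleftrightarrow> u = v" for u v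
    by (simp add: enc_def inj_map_eq_map)
  have "res level_tm 11 s (I (map enc F))"
    unfolding level_tm_def
  proof (rule res_Iter[where ?k1.0 = 12 and ?k2.0 = 13 and ?k3.0 = 14])
    fix us x zs v
    assume xs: "map enc F = us @ x # zs" and "I us v"
    then obtain G G' where G: "us = map enc G" "F = G @ G'" and v: "v = TNode
      (enc_frontier (extensions n (rev (filter is_prefix G))))
      (enc_terms f (rev (filter (\<lambda>w. w \<in> Poly_Mapping.keys f) G) @ ws))"
      by (auto simp: I_def)
    from xs G obtain u G'' where G': "G' = u # G''" "x = enc u" by auto
    have "res visit_tm 14 (s(11 := v, 12 := enc_list zs, 13 := x)) ((=) (TNode
      (enc_frontier (extensions n (filter is_prefix [u]) @ extensions n (rev (filter is_prefix G))))
      (enc_terms f (filter (\<lambda>w. w \<in> Poly_Mapping.keys f) [u] @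
        rev (filter (\<lambda>w. w \<in> Poly_Mapping.keys f) G) @ ws))))"
      using s v F(1)[of u] G G' by (intro res_visit) (auto simp: enc_def)
    then show "res visit_tm 14 (s(11 := v, 12 := enc_list zs, 13 := x)) (I (us @ [x]))"
    proof (rule res_mono)
      fix w
      assume "TNode
        (enc_frontier (extensions n (filter is_prefix [u]) @ extensions n (rev (filter is_prefix G))))
        (enc_terms f (filter (\<lambda>w. w \<in> Poly_Mapping.keys f) [u] @
          rev (filter (\<lambda>w. w \<in> Poly_Mapping.keys f) G) @ ws)) = w"
      then show "I (us @ [x]) w"
        unfolding I_def using G G'
        by (intro exI[of _ "G @ [u]"]) (auto simp: extensions_def)
    qed
  qed (use s F in \<open>auto intro!: res_Ret simp: enc_frontier_def enc_def[abs_def] I_def extensions_def\<close>)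
  then show ?thesis
    by (rule res_mono) (auto simp: I_def inj_map_eq_map[OF injI] inj)
qed

text \<open>These are candidates still to be probed, hence the condition on \<open>butlast u\<close>
  and not on \<open>u\<close>.\<close>

definition frontier :: "nat \<Rightarrow> nat list set" where
  "frontier j = {u. length u = j \<and> set u \<subseteq> {..<n} \<and> (u \<noteq> [] \<longrightarrow> is_prefix (butlast u))}"

lemma is_prefix_butlast: "is_prefix u \<Longrightarrow> is_prefix (butlast u)"
proof (cases "u = []")
  case False
  assume "is_prefix u"
  then obtain v where "u @ v \<in> Poly_Mapping.keys f" by (auto simp: is_prefix_def)
  moreover have "u @ v = butlast u @ (last u # v)" using False by simp
  ultimately show ?thesis unfolding is_prefix_def by metis
qed simp

lemma is_prefix_set: "is_prefix u \<Longrightarrow> set u \<subseteq> {..<n}"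
  using keysD(1) by (fastforce simp: is_prefix_def)

lemma keys_frontier: "w \<in> Poly_Mapping.keys f \<Longrightarrow> w \<in> frontier (length w)"
  using keys_is_prefix is_prefix_butlast is_prefix_set by (simp add: frontier_def)

lemma frontier_Suc: "frontier (Suc j) = {u @ [i] |u i. u \<in> frontier j \<and> is_prefix u \<and> i < n}"
proof (intro equalityI subsetI)
  fix w assume w: "w \<in> frontier (Suc j)"
  then obtain u i where "w = u @ [i]" by (cases w rule: rev_cases) (auto simp: frontier_def)
  with w show "w \<in> {u @ [i] |u i. u \<in> frontier j \<and> is_prefix u \<and> i < n}"
    by (auto simp: frontier_def is_prefix_butlast)
qed (auto simp: frontier_def)

text \<open>A candidate of length \<open>i + 1\<close> is \<open>take i w @ [l]\<close> for a
  monomial \<open>w\<close> and a letter \<open>l\<close>, which leaves at most \<open>t * n\<close>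
  choices; the extra 1 is for the empty word at level 0.\<close>

lemma card_frontier: "card (frontier j) \<le> Suc (n * t)"
proof (cases j)
  case 0
  then have "frontier j \<subseteq> {[]}" by (auto simp: frontier_def)
  then have "card (frontier j) \<le> card {[] :: nat list}" by (intro card_mono) auto
  then show ?thesis by simp
next
  case (Suc i)
  let ?g = "\<lambda>(w, l). take i w @ [l]"
  have "frontier j \<subseteq> ?g ` (Poly_Mapping.keys f \<times> {..<n})"
  proof
    fix w assume "w \<in> frontier j"
    then obtain u l where "w = u @ [l]" "u \<in> frontier i" "is_prefix u" "l < n"
      by (auto simp: Suc frontier_Suc)
    moreover from this obtain v where "u @ v \<in> Poly_Mapping.keys f" by (auto simp: is_prefix_def)
    moreover have "w = ?g (u @ v, l)" using calculation by (simp add: frontier_def)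
    ultimately show "w \<in> ?g ` (Poly_Mapping.keys f \<times> {..<n})" by blast
  qed
  then have "card (frontier j) \<le> card (?g ` (Poly_Mapping.keys f \<times> {..<n}))"
    by (intro card_mono) auto
  also have "\<dots> \<le> card (Poly_Mapping.keys f \<times> {..<n})" by (intro card_image_le) auto
  also have "\<dots> \<le> t * n" using card by (simp add: card_cartesian_product)
  finally show ?thesis by (simp add: mult.commute)
qed

lemma res_search:
  assumes s: "s 1 = enc_nat n" "s 2 = enc_nat d" "s 6 = enc_nat (n * d * t + 3)"
  shows "res search_tm 7 s (\<lambda>v. lists_monomials v f)"
proof -
  define I where "I us v \<longleftrightarrow> (\<exists>F ws. v = TNode (enc_frontier F) (enc_terms f ws)
    \<and> distinct F \<and> set F = frontier (length us)
    \<and> distinct ws \<and> set ws = {w \<in> Poly_Mapping.keys f. length w < length us})"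
    for us :: "'a tree list" and v :: "'a tree"
  have level: "res (Iter (Var 7) (Ret (ConsE (ConsE NilE NilE) NilE)) level_tm) 8
      (s(7 := enc_nat (Suc d))) (I (replicate (Suc d) TNil))"
  proof (rule res_Iter[where ?k1.0 = 9 and ?k2.0 = 10 and ?k3.0 = 11])
    fix us zs :: "'a tree list" and z v :: "'a tree"
    assume eq: "replicate (Suc d) TNil = us @ z # zs" and "I us v"
    then obtain F ws where v: "v = TNode (enc_frontier F) (enc_terms f ws)"
      and F: "distinct F" "set F = frontier (length us)"
      and ws: "distinct ws" "set ws = {w \<in> Poly_Mapping.keys f. length w < length us}"
      by (auto simp: I_def)
    from eq have "length (replicate (Suc d) (TNil :: 'a tree)) = length (us @ z # zs)" by (simp only:)
    then have len: "length us \<le> d" by simp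
    have "length F = card (frontier (length us))" using F by (simp add: distinct_card[symmetric])
    then have "length F \<le> K" using card_frontier K_frontier by (metis order_trans)
    then have "res level_tm 11 (s(7 := enc_nat (Suc d), 8 := v, 9 := enc_list zs, 10 := z)) ((=) (TNode
      (enc_frontier (extensions n (rev (filter is_prefix F))))
      (enc_terms f (rev (filter (\<lambda>w. w \<in> Poly_Mapping.keys f) F) @ ws))))"
      using s v F len by (intro res_level) (auto simp: frontier_def)
    then show "res level_tm 11 (s(7 := enc_nat (Suc d), 8 := v, 9 := enc_list zs, 10 := z))
      (I (us @ [z]))"
    proof (rule res_mono)
      fix v'
      assume v': "TNode (enc_frontier (extensions n (rev (filter is_prefix F))))
        (enc_terms f (rev (filter (\<lambda>w. w \<in> Poly_Mapping.keys f) F) @ ws)) = v'"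
      have "set (extensions n (rev (filter is_prefix F))) = frontier (Suc (length us))"
        using F by (auto simp: set_extensions frontier_Suc)
      \<comment> \<open>New terms have length exactly \<open>length us\<close> and old ones are
        shorter, so none is listed twice.\<close>
      moreover have "distinct (rev (filter (\<lambda>w. w \<in> Poly_Mapping.keys f) F) @ ws)"
        using F ws by (auto simp: frontier_def)
      moreover have "set (rev (filter (\<lambda>w. w \<in> Poly_Mapping.keys f) F) @ ws) =
          {w \<in> Poly_Mapping.keys f. length w < Suc (length us)}"
        using F ws keys_frontier by (auto simp: frontier_def less_Suc_eq)
      moreover have "distinct (extensions n (rev (filter is_prefix F)))"
        using F by (intro distinct_extensions) simp
      ultimately show "I (us @ [z]) v'"
        unfolding I_def v'[symmetric] by (auto intro!: exI)
    qed
  next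
    have "frontier 0 = {[]}" by (auto simp: frontier_def)
    then have "distinct [[]] \<and> set [[]] = frontier (length []) \<and> distinct [] \<and>
        set [] = {w \<in> Poly_Mapping.keys f. length w < length []}"
      by simp
    then have "I [] (TNode (enc_frontier [[]]) (enc_terms f []))"
      unfolding I_def by (metis length_0_conv)
    then show "res (Ret (ConsE (ConsE NilE NilE) NilE)) 8 (s(7 := enc_nat (Suc d))) (I [])"
      by (intro res_Ret) (auto simp: enc_frontier_def enc_terms_def)
  qed (use nd_le in \<open>auto simp: enc_nat_conv_list\<close>)
  show ?thesis
    unfolding search_tm_def
  proof (rule res_Let[where k' = 8 and v = "enc_nat (Suc d)"])
    show "res (Bind (Iter (Var 7) (Ret (ConsE (ConsE NilE NilE) NilE)) level_tm) (Ret (Tl (Var 8))))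
      8 (s(7 := enc_nat (Suc d))) (\<lambda>v. lists_monomials v f)"
    proof (rule res_Bind[OF level, where k' = 9], simp)
      fix v
      assume "I (replicate (Suc d) TNil) v"
      then obtain F ws where v: "v = TNode (enc_frontier F) (enc_terms f ws)"
        and ws: "distinct ws" "set ws = {w \<in> Poly_Mapping.keys f. length w < Suc d}"
        by (auto simp: I_def)
      from ws(2) keysD(2) have "set ws = Poly_Mapping.keys f" by (auto simp: less_Suc_eq_le)
      with ws(1) have "lists_monomials (enc_terms f ws) f"
        unfolding lists_monomials_def enc_terms_def by blast
      with v show "res (Ret (Tl (Var 8))) 9 (s(7 := enc_nat (Suc d), 8 := v))
          (\<lambda>v. lists_monomials v f)"
        by (intro res_Ret) auto
    qed
  qed (use s in \<open>auto intro!: res_Ret\<close>)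
qed

lemma res_main:
  assumes s: "s 1 = enc_nat n" "s 2 = enc_nat d" "s 3 = enc_nat t"
  shows "res main_tm 4 s (\<lambda>v. lists_monomials v f)"
  unfolding main_tm_def
  apply (rule res_Let[where k' = 5 and v = "enc_nat (n * d)"])
    apply (rule res_mult[where a = n and b = d]; use s nd_le in simp)
   apply simp
  apply (rule res_Let[where k' = 6 and v = "enc_nat (n * d * t)"])
    apply (rule res_mult[where a = "n * d" and b = t]; use s K_terms in simp)
   apply simp
  apply (rule res_Let[where k' = 7 and v = "enc_nat (n * d * t + 3)"])
    apply (rule res_Ret; simp add: numeral_3_eq_3)
   apply simp
  apply (rule res_search; use s in simp)
  done

end

subsection \<open>Reconstruction\<close>

text \<open>Horner's rule. The polynomial is fixed before the program, so each coefficient can be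
  added by that many constructors.\<close>

fun poly_tm :: "nat list \<Rightarrow> nat \<Rightarrow> nat \<Rightarrow> tm" where
  "poly_tm [] k x = Ret NilE"
| "poly_tm (c # cs) k x =
     Bind (poly_tm cs k x)
       (Bind (mult_tm (k + 1) x k) (Ret ((ConsE NilE ^^ c) (Var (k + 1)))))"

lemma evars_ConsE_pow [simp]: "evars ((ConsE NilE ^^ c) e) = evars e"
  by (induction c) auto

lemma expr_val_ConsE_pow: "expr_val e s = enc_nat a \<Longrightarrow> expr_val ((ConsE NilE ^^ c) e) s = enc_nat (c + a)"
  by (induction c) auto

definition program :: "tm \<Rightarrow> com" where
  "program T = Seq (compile T 1) (Assign 0 (Var 1))"

context machine
begin

text \<open>For \<open>a > 0\<close> the intermediate Horner values are at most the final one. For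
  \<open>a = 0\<close> they may exceed it, but then the multiplications perform no
  additions.\<close>

lemma res_poly:
  assumes "x < k" "s x = enc_nat a" "a \<le> K" "0 < a \<Longrightarrow> poly (Poly cs) a \<le> K"
    and "Q (enc_nat (poly (Poly cs) a))"
  shows "res (poly_tm cs k x) k s Q"
  using assms(4,5)
proof (induction cs arbitrary: Q)
  case Nil
  then show ?case by (auto intro!: res_Ret)
next
  case (Cons c cs)
  let ?b = "poly (Poly cs) a"
  have b: "?b \<le> K" if "0 < a"
  proof -
    have "?b \<le> a * ?b" using that by simp
    also have "\<dots> \<le> poly (Poly (c # cs)) a" by simp
    finally show ?thesis using Cons.prems(1)[OF that] by (rule order_trans)
  qed
  have "res (poly_tm cs k x) k s ((=) (enc_nat ?b))"
    using b by (intro Cons.IH) auto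
  moreover have "res (mult_tm (k + 1) x k) (k + 1) (s(k := enc_nat ?b)) ((=) (enc_nat (a * ?b)))"
    using assms b by (intro res_mult[where a = a and b = ?b]) auto
  moreover have "res (Ret ((ConsE NilE ^^ c) (Var (k + 1)))) (k + 2)
      (s(k := enc_nat ?b, k + 1 := enc_nat (a * ?b))) Q"
    using Cons.prems(2) by (intro res_Ret) (auto simp: expr_val_ConsE_pow[of _ _ "a * ?b"])
  ultimately show ?case
    unfolding poly_tm.simps
    by - (rule res_Let[where k' = "k + 1"], assumption, simp, rule res_Let[where k' = "k + 2"], auto)
qed

lemma res_computes:
  assumes "res T 1 ((\<lambda>_. TNil)(0 := inp)) Q"
  obtains out time where "computes n bb (poly q) (program T) inp out time" "Q out"
    "time \<le> poly (tpoly q T) K + 2"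
proof -
  obtain s1 T1 where 1: "ex (compile T 1) ((\<lambda>_. TNil)(0 := inp)) s1 T1"
    "Q (s1 1)" "T1 \<le> poly (tpoly q T) K"
    using resE[OF assms, of "(\<lambda>_. TNil)(0 := inp)"] by blast
  have "ex (Assign 0 (Var 1)) s1 (s1(0 := s1 1)) 2"
    using ExAssign[of n bb "poly q" 0 "Var 1" s1] by (simp add: numeral_2_eq_2)
  then have "computes n bb (poly q) (program T) inp (s1 1) (T1 + 2)"
    using ExSeq[OF 1(1)] unfolding computes_def program_def by fastforce
  with 1 that show ?thesis by simp
qed

end

text \<open>With \<open>a = 4 + z\<close>, both \<open>4 + d\<close> and \<open>n * d * t\<close>
  are at most \<open>a ^ 3\<close>, their sum is at most \<open>2 * a ^ 3 \<le> a ^ 4\<close>, and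
  the factor \<open>Suc n \<le> a\<close> raises the exponent to 5.\<close>

lemma black_boxI:
  assumes "f \<in> ncpolys n" "nc_degree f \<le> d" "card (Poly_Mapping.keys f) \<le> t" "n + d + t \<le> z"
  shows "black_box n f ((4 + z) ^ 5) d t"
proof
  let ?a = "4 + z"
  have pow5: "(a * (a * a * a)) * a = a ^ 5" for a :: nat by (simp add: eval_nat_numeral)
  have pow: "?a ^ i \<le> ?a ^ 5" if "i \<le> 5" for i using that by (intro power_increasing) auto
  have nd: "n * d \<le> ?a * ?a" "n * t \<le> ?a * ?a" and ndt: "n * d * t \<le> ?a * ?a * ?a"
    using assms(4) by (auto intro!: mult_mono)
  have "4 + d \<le> ?a" using assms(4) by simp
  also have "?a \<le> ?a * ?a * ?a" by simp
  finally have "Suc (d + (n * d * t + 3)) \<le> ?a * ?a * ?a + ?a * ?a * ?a"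
    using ndt by linarith
  also have "\<dots> = 2 * (?a * ?a * ?a)" by (simp only: mult_2)
  also have "\<dots> \<le> ?a * (?a * ?a * ?a)" by (intro mult_right_mono) auto
  finally have "Suc (d + (n * d * t + 3)) * Suc n \<le> (?a * (?a * ?a * ?a)) * ?a"
    using assms(4) by (intro mult_mono) auto
  also have "\<dots> = ?a ^ 5" by (rule pow5)
  finally show "Suc (d + (n * d * t + 3)) * Suc n \<le> ?a ^ 5" .
  have "?a * ?a \<le> ?a ^ 5" using pow[of 2] by (simp add: power2_eq_square)
  with nd(1) show "n * d \<le> ?a ^ 5" by (rule order_trans)
  have "n * t \<le> z * z" using assms(4) by (intro mult_mono) auto
  then have "Suc (n * t) \<le> ?a * ?a" by (simp add: algebra_simps)
  with \<open>?a * ?a \<le> ?a ^ 5\<close> show "Suc (n * t) \<le> ?a ^ 5" by (rule order_trans[rotated])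
  show "t \<le> ?a ^ 5" using assms(4) pow[of 1] by simp
qed (use assms in auto)

theorem theorem5:
  shows
    "(\<exists>P. \<forall>q :: nat poly. \<exists>p :: nat poly.
        \<forall>n d t. \<forall>f :: 'a::field ncpoly.
          f \<in> ncpolys n \<longrightarrow> nc_degree f \<le> d \<longrightarrow> card (Poly_Mapping.keys f) \<le> t \<longrightarrow>
          (\<exists>out T. computes n (nc_eval f) (poly q) P
                     (enc_list [enc_nat n, enc_nat d, enc_nat t]) out T
             \<and> lists_monomials out f \<and> T \<le> poly p (d + n + t))) \<and>
     (\<forall>D S :: nat poly. \<exists>P. \<forall>q :: nat poly. \<exists>p :: nat poly.
        \<forall>n. \<forall>f :: 'a ncpoly.
          f \<in> ncpolys n \<longrightarrow> nc_degree f \<le> poly D n \<longrightarrow> card (Poly_Mapping.keys f) \<le> poly S n \<longrightarrow>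
          (\<exists>out T. computes n (nc_eval f) (poly q) P (enc_nat n) out T
             \<and> lists_monomials out f \<and> T \<le> poly p n))"
proof (intro conjI allI)
  define T where "T = Bind (Ret (Hd (Var 0))) (Bind (Ret (Hd (Tl (Var 0))))
    (Bind (Ret (Hd (Tl (Tl (Var 0))))) main_tm))"
  show "\<exists>P. \<forall>q :: nat poly. \<exists>p :: nat poly.
        \<forall>n d t. \<forall>f :: 'a::field ncpoly.
          f \<in> ncpolys n \<longrightarrow> nc_degree f \<le> d \<longrightarrow> card (Poly_Mapping.keys f) \<le> t \<longrightarrow>
          (\<exists>out T. computes n (nc_eval f) (poly q) P
                     (enc_list [enc_nat n, enc_nat d, enc_nat t]) out T
             \<and> lists_monomials out f \<and> T \<le> poly p (d + n + t))"
  \<comment> \<open>The program does not depend on \<open>q\<close>; the query cost enters only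
    through \<open>tpoly q T\<close>, evaluated at the bound \<open>K\<close>. The final 2 pays for
    copying the result to variable 0.\<close>
  proof (rule exI[of _ "program T"], rule allI,
      rule_tac x = "pcompose (tpoly q T) ([:4, 1:] ^ 5) + [:2:]" in exI, intro allI impI)
    fix q :: "nat poly" and n d t and f :: "'a ncpoly"
    assume f: "f \<in> ncpolys n" "nc_degree f \<le> d" "card (Poly_Mapping.keys f) \<le> t"
    interpret black_box n f q "(4 + (d + n + t)) ^ 5" d t
      using f by (intro black_boxI) auto
    have "res T 1 ((\<lambda>_. TNil)(0 := enc_list [enc_nat n, enc_nat d, enc_nat t]))
        (\<lambda>v. lists_monomials v f)"
      unfolding T_def
      apply (rule res_Let[where k' = 2 and v = "enc_nat n"])
        apply (rule res_Ret; simp)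
       apply simp
      apply (rule res_Let[where k' = 3 and v = "enc_nat d"])
        apply (rule res_Ret; simp)
       apply simp
      apply (rule res_Let[where k' = 4 and v = "enc_nat t"])
        apply (rule res_Ret; simp)
       apply simp
      apply (rule res_main; simp)
      done
    from res_computes[OF this] obtain out time where
      "computes n (nc_eval f) (poly q) (program T) (enc_list [enc_nat n, enc_nat d, enc_nat t]) out time"
      "lists_monomials out f" "time \<le> poly (tpoly q T) ((4 + (d + n + t)) ^ 5) + 2"
      by blast
    moreover have "poly (pcompose (tpoly q T) ([:4, 1:] ^ 5) + [:2:]) (d + n + t)
        = poly (tpoly q T) ((4 + (d + n + t)) ^ 5) + 2"
      by (simp add: poly_pcompose)
    ultimately show "\<exists>out time. computes n (nc_eval f) (poly q) (program T)
          (enc_list [enc_nat n, enc_nat d, enc_nat t]) out time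
        \<and> lists_monomials out f \<and> time \<le> poly (pcompose (tpoly q T) ([:4, 1:] ^ 5) + [:2:]) (d + n + t)"
      by metis
  qed
next
  fix D S :: "nat poly"
  \<comment> \<open>The bounds \<open>poly D n\<close> and \<open>poly S n\<close> are computed from
    \<open>n\<close> and placed where \<open>main_tm\<close> expects \<open>d\<close> and
    \<open>t\<close>.\<close>
  define T where "T = Bind (Ret (Var 0)) (Bind (poly_tm (coeffs D) 2 1)
    (Bind (poly_tm (coeffs S) 3 1) main_tm))"
  show "\<exists>P. \<forall>q :: nat poly. \<exists>p :: nat poly. \<forall>n. \<forall>f :: 'a ncpoly.
          f \<in> ncpolys n \<longrightarrow> nc_degree f \<le> poly D n \<longrightarrow> card (Poly_Mapping.keys f) \<le> poly S n \<longrightarrow>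
          (\<exists>out T. computes n (nc_eval f) (poly q) P (enc_nat n) out T
             \<and> lists_monomials out f \<and> T \<le> poly p n)"
  proof (rule exI[of _ "program T"], rule allI,
      rule_tac x = "pcompose (tpoly q T) (([:4, 1:] + D + S) ^ 5) + [:2:]" in exI, intro allI impI)
    fix q :: "nat poly" and n and f :: "'a ncpoly"
    assume f: "f \<in> ncpolys n" "nc_degree f \<le> poly D n" "card (Poly_Mapping.keys f) \<le> poly S n"
    let ?z = "n + poly D n + poly S n"
    interpret black_box n f q "(4 + ?z) ^ 5" "poly D n" "poly S n"
      using f by (intro black_boxI) auto
    have "(4 + ?z) ^ 1 \<le> (4 + ?z) ^ 5" by (intro power_increasing) auto
    then have bounds: "n \<le> (4 + ?z) ^ 5" "poly D n \<le> (4 + ?z) ^ 5" "poly S n \<le> (4 + ?z) ^ 5"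
      by auto
    have "res T 1 ((\<lambda>_. TNil)(0 := enc_nat n)) (\<lambda>v. lists_monomials v f)"
      unfolding T_def
      apply (rule res_Let[where k' = 2 and v = "enc_nat n"])
        apply (rule res_Ret; simp)
       apply simp
      apply (rule res_Let[where k' = 3 and v = "enc_nat (poly D n)"])
        apply (rule res_poly[where a = n]; use bounds in simp)
       apply simp
      apply (rule res_Let[where k' = 4 and v = "enc_nat (poly S n)"])
        apply (rule res_poly[where a = n]; use bounds in simp)
       apply simp
      apply (rule res_main; simp)
      done
    from res_computes[OF this] obtain out time where
      "computes n (nc_eval f) (poly q) (program T) (enc_nat n) out time"
      "lists_monomials out f" "time \<le> poly (tpoly q T) ((4 + ?z) ^ 5) + 2"
      by blast
    moreover have "poly (pcompose (tpoly q T) (([:4, 1:] + D + S) ^ 5) + [:2:]) n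
        = poly (tpoly q T) ((4 + ?z) ^ 5) + 2"
      by (simp add: poly_pcompose add.assoc)
    ultimately show "\<exists>out time. computes n (nc_eval f) (poly q) (program T) (enc_nat n) out time
        \<and> lists_monomials out f
        \<and> time \<le> poly (pcompose (tpoly q T) (([:4, 1:] + D + S) ^ 5) + [:2:]) n"
      by metis
  qed
qed

end
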